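(* Let $G$ be a countable elementary amenable group. Then $\operatorname{asdim}(G)\le h(G)$, where $h(G)$ is the Hirsch length of $G$.
   Context: Asymptotic dimension. A metric space $X$ has $\operatorname{asdim}(X)\le n$ if for every $R>0$ there is $S>0$ and a cover of $X$ by sets of diameter at most $S$ such that any $n+2$ distinct members have empty intersection and every non-empty subset of $X$ of diameter at most $R$ lies in some member of the cover. $\operatorname{asdim}(X)\in\{0,1,2,\dots\}\cup\{\infty\}$ is the least such $n$, or $\infty$ if there is none. For a countable group $G$, $\operatorname{asdim}(G)$ is that of $(G,d)$ for any proper (balls are finite) right-invariant metric $d$; it does not depend on $d$. Elementary amenable groups and Hirsch length. Let $\mathfrak X_0=\{1\}$, let $\mathfrak X_1$ be the class of virtually abelian groups, let $\mathfrak X_{\alpha+1}$ be the class of groups having a normal subgroup in $L\mathfrak X_\alpha$ with quotient in $\mathfrak X_1$ (where $L\mathfrak X_\alpha$ is the class of groups all of whose finitely generated subgroups lie in $\mathfrak X_\alpha$), and let $\mathfrak X_\beta=\bigcup_{\alpha<\beta}\mathfrak X_\alpha$ for limit ordinals $\beta$. A group is elementary amenable if it lies in $\bigcup_\alpha\mathfrak X_\alpha$. The Hirsch length $h(G)\in\{0,1,2,\dots\}\cup\{\infty\}$ is defined by: $h(G)=\dim_{\mathbb Q}(A\otimes\mathbb Q)$ if $G\in\mathfrak X_1$ has the finite-index abelian subgroup $A$; $h(H)=\sup\{h(F): F\le H,\ F\in\mathfrak X_\alpha\}$ for $H\in L\mathfrak X_\alpha$; and $h(G)=h(N)+h(G/N)$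 if $N\triangleleft G$, $N\in L\mathfrak X_\alpha$, $G/N\in\mathfrak X_1$. It is known that $h$ is well defined. *)

theory Defs
  imports
    "HOL-Analysis.Abstract_Metric_Spaces"
    "HOL-Algebra.Free_Abelian_Groups"
    "HOL-Library.Extended_Nat"
    "Jordan_Normal_Form.Missing_VectorSpace"
begin

section \<open>Asymptotic dimension\<close>

definition diam_le :: "('a \<Rightarrow> 'a \<Rightarrow> real) \<Rightarrow> 'a set \<Rightarrow> real \<Rightarrow> bool"
  where "diam_le d A r \<longleftrightarrow> (\<forall>x\<in>A. \<forall>y\<in>A. d x y \<le> r)"

definition asdim_le :: "'a set \<Rightarrow> ('a \<Rightarrow> 'a \<Rightarrow> real) \<Rightarrow> nat \<Rightarrow> bool"
  where "asdim_le X d n \<longleftrightarrow>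
    (\<forall>R>0. \<exists>S>0. \<exists>\<U>. \<U> \<subseteq> Pow X \<and> \<Union>\<U> = X \<and>
       (\<forall>U\<in>\<U>. diam_le d U S) \<and>
       (\<forall>\<V>\<subseteq>\<U>. card \<V> = n + 2 \<longrightarrow> \<Inter>\<V> = {}) \<and>
       (\<forall>A\<subseteq>X. A \<noteq> {} \<and> diam_le d A R \<longrightarrow> (\<exists>U\<in>\<U>. A \<subseteq> U)))"

definition asdim :: "'a set \<Rightarrow> ('a \<Rightarrow> 'a \<Rightarrow> real) \<Rightarrow> enat"
  where "asdim X d = (if \<exists>n. asdim_le X d n then enat (LEAST n. asdim_le X d n) else \<infinity>)"

definition proper_right_invariant_metric :: "'a monoid \<Rightarrow> ('a \<Rightarrow> 'a \<Rightarrow> real) \<Rightarrow> bool"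
  where "proper_right_invariant_metric G d \<longleftrightarrow>
    Metric_space (carrier G) d \<and>
    (\<forall>x\<in>carrier G. \<forall>r. finite (Metric_space.mcball (carrier G) d x r)) \<and>
    (\<forall>x\<in>carrier G. \<forall>y\<in>carrier G. \<forall>g\<in>carrier G. d (x \<otimes>\<^bsub>G\<^esub> g) (y \<otimes>\<^bsub>G\<^esub> g) = d x y)"

section \<open>The rational vector space \<open>A \<otimes> \<rat>\<close>\<close>

definition rat_field :: "rat ring"
  where "rat_field = \<lparr>carrier = UNIV, monoid.mult = (*), one = 1, zero = 0, add = (+)\<rparr>"

abbreviation tensor_gens :: "'a monoid \<Rightarrow> ('a \<times> rat \<Rightarrow>\<^sub>0 int) monoid"
  where "tensor_gens A \<equiv> free_Abelian_group (carrier A \<times> UNIV)"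

definition tensor_rels :: "'a monoid \<Rightarrow> ('a \<times> rat \<Rightarrow>\<^sub>0 int) set"
  where "tensor_rels A = generate (tensor_gens A)
    ({frag_of (a \<otimes>\<^bsub>A\<^esub> b, q) - frag_of (a, q) - frag_of (b, q) |a b q. a \<in> carrier A \<and> b \<in> carrier A} \<union>
     {frag_of (a, p + q) - frag_of (a, p) - frag_of (a, q) |a p q. a \<in> carrier A})"

text \<open>
  The tensor product over the integers of a (multiplicatively written) abelian group \<open>A\<close> with the
  rationals: the free abelian group on the symbols \<open>(a, q)\<close>, i.e. \<open>a \<otimes> q\<close>, modulo
  biadditivity, where \<open>s\<close> acts by \<open>a \<otimes> q \<mapsto> a \<otimes> (s * q)\<close>.
  The ring fields \<open>mult\<close> and \<open>one\<close> of the module record play no role.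
\<close>

definition rat_tensor :: "'a monoid \<Rightarrow> (rat, ('a \<times> rat \<Rightarrow>\<^sub>0 int) set) module"
  where "rat_tensor A =
    \<lparr>carrier = carrier (tensor_gens A Mod tensor_rels A),
     monoid.mult = undefined, one = undefined,
     zero = \<one>\<^bsub>tensor_gens A Mod tensor_rels A\<^esub>,
     add = (\<otimes>\<^bsub>tensor_gens A Mod tensor_rels A\<^esub>),
     smult = (\<lambda>s C. \<Union>c\<in>C. tensor_rels A #>\<^bsub>tensor_gens A\<^esub>
                 frag_extend (\<lambda>(a, q). frag_of (a, s * q)) c)\<rparr>"

lemma field_rat_field: "field rat_field"
proof (rule cring.cring_fieldI2)
  show "cring rat_field"
    by (rule cringI, rule abelian_groupI, auto simp: rat_field_def comm_monoid_def monoid_def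
        comm_monoid_axioms_def algebra_simps intro: exI[of _ "- x" for x])
  show "\<exists>b\<in>carrier rat_field. a \<otimes>\<^bsub>rat_field\<^esub> b = \<one>\<^bsub>rat_field\<^esub>"
    if "a \<in> carrier rat_field" "a \<noteq> \<zero>\<^bsub>rat_field\<^esub>" for a
    using that by (auto simp: rat_field_def intro: exI[of _ "inverse a"])
qed (auto simp: rat_field_def)

lemma vectorspace_rat_tensor:
  assumes A: "comm_group A"
  shows "vectorspace rat_field (rat_tensor A)"
proof -
  interpret A: comm_group A by fact
  define F where "F = tensor_gens A"
  define E where "E =
    {frag_of (a \<otimes>\<^bsub>A\<^esub> b, q) - frag_of (a, q) - frag_of (b, q) |a b q. a \<in> carrier A \<and> b \<in> carrier A} \<union>
    {frag_of (a, p + q) - frag_of (a, p) - frag_of (a, q) |a p q::rat. a \<in> carrier A}"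
  define W where "W = tensor_rels A"
  define sc :: "rat \<Rightarrow> ('a \<times> rat \<Rightarrow>\<^sub>0 int) \<Rightarrow> ('a \<times> rat \<Rightarrow>\<^sub>0 int)"
    where "sc s = frag_extend (\<lambda>(a, q). frag_of (a, s * q))" for s
  interpret F: comm_group F
    unfolding F_def by (rule abelian_free_Abelian_group)
  have F_mult: "x \<otimes>\<^bsub>F\<^esub> y = x + y" and F_one: "\<one>\<^bsub>F\<^esub> = 0" for x y
    by (simp_all add: F_def)
  have F_inv: "inv\<^bsub>F\<^esub> x = - x" if "x \<in> carrier F" for x
    using that by (simp add: F_def)
  have F_of: "frag_of (a, q) \<in> carrier F" if "a \<in> carrier A" for a q
    using that by (simp add: F_def)
  have F_minus: "x - y \<in> carrier F" if "x \<in> carrier F" "y \<in> carrier F" for x y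
    using F.m_closed[OF that(1) F.inv_closed[OF that(2)]] F_inv[OF that(2)] F_mult by simp
  have E_sub: "E \<subseteq> carrier F"
    unfolding E_def by (auto intro!: F_minus F_of)
  have W_gen: "W = generate F E"
    by (simp add: W_def tensor_rels_def F_def E_def)
  have W_sub: "subgroup W F"
    unfolding W_gen by (rule F.generate_is_subgroup[OF E_sub])
  then interpret N: normal W F
    by (simp add: F.normal_iff_subgroup)
  have W_plus: "x + y \<in> W" if "x \<in> W" "y \<in> W" for x y
    using N.m_closed[OF that] F_mult by simp
  have W_uminus: "- x \<in> W" if "x \<in> W" for x
    using N.m_inv_closed[OF that] F_inv N.subset that by auto
  have W_zero: "0 \<in> W"
    using N.one_closed F_one by simp
  have sc_add: "sc s (x + y) = sc s x + sc s y" for s x y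
    by (simp add: sc_def frag_extend_add)
  have sc_minus: "sc s (x - y) = sc s x - sc s y" for s x y
    by (simp add: sc_def frag_extend_diff)
  have sc_uminus: "sc s (- x) = - sc s x" for s x
    by (simp add: sc_def frag_extend_minus)
  have sc_of [simp]: "sc s (frag_of (a, q)) = frag_of (a, s * q)" for s a q
    by (simp add: sc_def)
  have sc_sc: "sc s (sc t x) = sc (s * t) x" for s t x
    by (induction x rule: frag_induction[OF subset_UNIV])
       (auto simp: sc_minus mult.assoc, simp_all add: sc_def)
  have sc_1: "sc 1 x = x" for x
    by (induction x rule: frag_induction[OF subset_UNIV])
       (auto simp: sc_minus, simp_all add: sc_def)
  have keysF: "x \<in> carrier F \<longleftrightarrow> Poly_Mapping.keys x \<subseteq> carrier A \<times> UNIV" for x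
    by (simp add: F_def)
  have sc_F: "sc s x \<in> carrier F" if "x \<in> carrier F" for s x
    using that unfolding keysF[of x]
  proof (induction x rule: frag_induction)
    case zero
    then show ?case using F.one_closed by (simp add: sc_def F_one)
  next
    case (one x)
    then show ?case by (cases x) (auto intro: F_of)
  next
    case (diff a b)
    then show ?case by (simp add: sc_minus F_minus)
  qed
  have sc_E: "sc s x \<in> W" if "x \<in> E" for s x
  proof -
    have "sc s x \<in> E"
      using that unfolding E_def by (fastforce simp: sc_minus distrib_left)
    then show ?thesis unfolding W_gen by (rule generate.incl)
  qed
  have sc_W: "sc s x \<in> W" if "x \<in> W" for s x
    using that unfolding W_gen
  proof (induction x rule: generate.induct)
    case one
    then show ?case using W_zero by (simp add: F_one sc_def W_gen)
  next
    case (incl h)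
    then show ?case using sc_E W_gen by simp
  next
    case (inv h)
    then have "h \<in> carrier F" using E_sub by blast
    then show ?case using W_uminus[OF sc_E[OF inv]] by (simp add: F_inv sc_uminus W_gen)
  next
    case (eng h1 h2)
    then show ?case using W_plus by (simp add: F_mult sc_add W_gen)
  qed
  have sc_l: "sc (s + t) x - (sc s x + sc t x) \<in> W" if "x \<in> carrier F" for s t x
    using that unfolding keysF[of x]
  proof (induction x rule: frag_induction)
    case zero
    then show ?case using W_zero by (simp add: sc_def)
  next
    case (one x)
    then obtain a q where x: "x = (a, q)" and a: "a \<in> carrier A" by auto
    have "frag_of (a, s * q + t * q) - frag_of (a, s * q) - frag_of (a, t * q) \<in> E"
      unfolding E_def using a by blast
    then show ?case
      unfolding W_gen by (auto simp: x distrib_right diff_diff_eq intro: generate.incl)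
  next
    case (diff a b)
    have "sc (s + t) (a - b) - (sc s (a - b) + sc t (a - b)) =
        (sc (s + t) a - (sc s a + sc t a)) + - (sc (s + t) b - (sc s b + sc t b))"
      by (simp add: sc_minus)
    then show ?case using W_plus[OF diff(1) W_uminus[OF diff(2)]] by simp
  qed
  have coset_eq: "W #>\<^bsub>F\<^esub> x = W #>\<^bsub>F\<^esub> y" if "x - y \<in> W" "x \<in> carrier F" "y \<in> carrier F" for x y
  proof (rule F.repr_independence[OF _ _ W_sub, symmetric])
    show "y \<in> carrier F" by fact
    show "x \<in> W #>\<^bsub>F\<^esub> y"
      unfolding r_coset_def using that(1) by (force simp: F_mult)
  qed
  have coset_D: "x - c \<in> W" "x \<in> carrier F" if "x \<in> W #>\<^bsub>F\<^esub> c" "c \<in> carrier F" for x c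
    using that N.subset F.m_closed F_mult by (auto simp: r_coset_def)
  let ?M = "rat_tensor A"
  have M_carrier: "carrier ?M = (\<lambda>c. W #>\<^bsub>F\<^esub> c) ` carrier F"
    by (auto simp: rat_tensor_def FactGroup_def RCOSETS_def W_def F_def)
  have M_add: "(W #>\<^bsub>F\<^esub> x) \<oplus>\<^bsub>?M\<^esub> (W #>\<^bsub>F\<^esub> y) = W #>\<^bsub>F\<^esub> (x + y)"
    if "x \<in> carrier F" "y \<in> carrier F" for x y
    using N.rcos_sum[OF that] by (simp add: rat_tensor_def FactGroup_def F_mult W_def F_def)
  have M_smult: "s \<odot>\<^bsub>?M\<^esub> (W #>\<^bsub>F\<^esub> c) = W #>\<^bsub>F\<^esub> sc s c" if "c \<in> carrier F" for s c
  proof -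
    have "W #>\<^bsub>F\<^esub> sc s x = W #>\<^bsub>F\<^esub> sc s c" if "x \<in> W #>\<^bsub>F\<^esub> c" for x
      using coset_D[OF that \<open>c \<in> carrier F\<close>] sc_W[of "x - c" s] \<open>c \<in> carrier F\<close>
      by (intro coset_eq) (auto simp: sc_minus sc_F)
    moreover have "c \<in> W #>\<^bsub>F\<^esub> c"
      by (rule F.rcos_self[OF that W_sub])
    ultimately have "(\<Union>x\<in>W #>\<^bsub>F\<^esub> c. W #>\<^bsub>F\<^esub> sc s x) = W #>\<^bsub>F\<^esub> sc s c"
      by blast
    then show ?thesis by (simp add: rat_tensor_def W_def F_def sc_def)
  qed
  interpret Q: comm_group "F Mod W"
    by (rule F.abelian_FactGroup[OF W_sub])
  have M_eqs: "carrier ?M = carrier (F Mod W)" "add ?M = monoid.mult (F Mod W)"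
    "\<zero>\<^bsub>?M\<^esub> = \<one>\<^bsub>F Mod W\<^esub>"
    by (simp_all add: rat_tensor_def W_def F_def)
  have M: "abelian_group ?M"
    by (rule abelian_groupI; unfold M_eqs)
       (rule Q.m_closed Q.one_closed Q.m_assoc Q.m_comm Q.l_one Q.l_inv_ex; assumption)+
  have "Module.module rat_field ?M"
  proof (rule moduleI)
    show "cring rat_field"
      using field_rat_field by (simp add: field_def domain_def)
    show "abelian_group ?M" by fact
  next
    fix s x assume "x \<in> carrier ?M"
    then show "s \<odot>\<^bsub>?M\<^esub> x \<in> carrier ?M" and "\<one>\<^bsub>rat_field\<^esub> \<odot>\<^bsub>?M\<^esub> x = x"
      unfolding M_carrier by (auto simp: M_smult sc_F rat_field_def sc_1)
  next
    fix s t x assume "x \<in> carrier ?M"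
    then obtain c where c: "c \<in> carrier F" "x = W #>\<^bsub>F\<^esub> c" unfolding M_carrier by auto
    show "(s \<oplus>\<^bsub>rat_field\<^esub> t) \<odot>\<^bsub>?M\<^esub> x = s \<odot>\<^bsub>?M\<^esub> x \<oplus>\<^bsub>?M\<^esub> t \<odot>\<^bsub>?M\<^esub> x"
      using c coset_eq[OF sc_l[of c s t]] F.m_closed[of "sc s c" "sc t c"]
      by (simp add: M_smult M_add sc_F F_mult rat_field_def)
    show "(s \<otimes>\<^bsub>rat_field\<^esub> t) \<odot>\<^bsub>?M\<^esub> x = s \<odot>\<^bsub>?M\<^esub> (t \<odot>\<^bsub>?M\<^esub> x)"
      using c by (simp add: M_smult sc_F sc_sc rat_field_def)
  next
    fix s x y assume "x \<in> carrier ?M" "y \<in> carrier ?M"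
    then show "s \<odot>\<^bsub>?M\<^esub> (x \<oplus>\<^bsub>?M\<^esub> y) = s \<odot>\<^bsub>?M\<^esub> x \<oplus>\<^bsub>?M\<^esub> s \<odot>\<^bsub>?M\<^esub> y"
      unfolding M_carrier using F.m_closed by (auto simp: M_smult M_add sc_F sc_add F_mult)
  qed
  then show ?thesis
    using field_rat_field by (simp add: vectorspace_def)
qed

definition rat_rank :: "'a monoid \<Rightarrow> enat"
  where "rat_rank A =
    (if vectorspace.fin_dim rat_field (rat_tensor A)
     then enat (vectorspace.dim rat_field (rat_tensor A)) else \<infinity>)"

section \<open>Elementary amenable groups\<close>

definition finite_index_abelian :: "'a set \<Rightarrow> 'a monoid \<Rightarrow> bool"
  where "finite_index_abelian A G \<longleftrightarrow>
    group G \<and> subgroup A G \<and> finite (rcosets\<^bsub>G\<^esub> A) \<and> comm_group (G\<lparr>carrier := A\<rparr>)"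

definition virtually_abelian :: "'a monoid \<Rightarrow> bool"
  where "virtually_abelian G \<longleftrightarrow> (\<exists>A. finite_index_abelian A G)"

definition locally_in :: "'a monoid set \<Rightarrow> 'a monoid set"
  where "locally_in \<X> =
    {G. group G \<and> (\<forall>S. finite S \<and> S \<subseteq> carrier G \<longrightarrow> G\<lparr>carrier := generate G S\<rparr> \<in> \<X>)}"

text \<open>
  The classes \<open>X\<^sub>\<alpha>\<close>, restricted to groups with carrier in a fixed type, by transfinite
  recursion on the position \<open>\<alpha>\<close> in a well-order \<open>r\<close>.
\<close>

definition ea_class :: "'i rel \<Rightarrow> 'i \<Rightarrow> 'a monoid set"
  where "ea_class r = worecZSL r
    {G. group G \<and> carrier G = {\<one>\<^bsub>G\<^esub>}}
    (\<lambda>\<alpha> \<X>. if \<alpha> = wo_rel.zero r then {G. virtually_abelian G}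
       else {G. group G \<and> (\<exists>N. N \<lhd> G \<and> G\<lparr>carrier := N\<rparr> \<in> locally_in \<X> \<and> virtually_abelian (G Mod N))})
    (\<lambda>f \<beta>. \<Union>\<alpha>\<in>underS r \<beta>. f \<alpha>)"

lemma adm_woL_Union:
  assumes "Well_order r"
  shows "adm_woL r (\<lambda>f \<beta>. \<Union>\<alpha>\<in>underS r \<beta>. f \<alpha>)"
  using assms by (auto simp: wo_rel_def wo_rel.adm_woL_def)

lemma ea_class_zero:
  assumes "Well_order r"
  shows "ea_class r (wo_rel.zero r) = {G. group G \<and> carrier G = {\<one>\<^bsub>G\<^esub>}}"
  using assms unfolding ea_class_def
  by (intro wo_rel.worecZSL_zero adm_woL_Union) (auto simp: wo_rel_def)

lemma ea_class_succ:
  assumes "Well_order r" and "aboveS r \<alpha> \<noteq> {}"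
  shows "ea_class r (wo_rel.succ r \<alpha>) =
    (if \<alpha> = wo_rel.zero r then {G. virtually_abelian G}
     else {G. group G \<and> (\<exists>N. N \<lhd> G \<and> G\<lparr>carrier := N\<rparr> \<in> locally_in (ea_class r \<alpha>) \<and>
                         virtually_abelian (G Mod N))})"
  using assms unfolding ea_class_def
  by (subst wo_rel.worecZSL_succ) (auto simp: wo_rel_def intro: adm_woL_Union)

lemma ea_class_limit:
  assumes "Well_order r" and "isLim r \<beta>" and "\<beta> \<noteq> wo_rel.zero r"
  shows "ea_class r \<beta> = (\<Union>\<alpha>\<in>underS r \<beta>. ea_class r \<alpha>)"
  using assms unfolding ea_class_def
  by (subst wo_rel.worecZSL_isLim) (auto simp: wo_rel_def intro: adm_woL_Union)

text \<open>
  \<open>\<X>\<close> is one of the classes \<open>X\<^sub>\<alpha>\<close>. Restricted to groups over the type \<open>'a\<close> the hierarchy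
  grows strictly until it becomes stationary, so at most as many ordinals matter as \<open>'a monoid\<close>
  has elements; every such ordinal is a position in a well-order on the larger type
  \<open>'a monoid set\<close>.
\<close>

definition is_ea_class :: "'a monoid set \<Rightarrow> bool"
  where "is_ea_class \<X> \<longleftrightarrow>
    (\<exists>(r :: 'a monoid set rel) \<alpha>. Well_order r \<and> \<alpha> \<in> Field r \<and> \<X> = ea_class r \<alpha>)"

definition elementary_amenable :: "'a monoid \<Rightarrow> bool"
  where "elementary_amenable G \<longleftrightarrow> (\<exists>\<X>. is_ea_class \<X> \<and> G \<in> \<X>)"

section \<open>Hirsch length\<close>

text \<open>
  \<open>hirsch_value G n\<close>: the defining clauses of the Hirsch length allow to compute \<open>h(G) = n\<close>.
  In the clause for extensions the virtually abelian quotient lives over the type \<open>'a set\<close>, so its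
  Hirsch length is spelled out by the first clause.
\<close>

inductive hirsch_value :: "'a monoid \<Rightarrow> enat \<Rightarrow> bool" where
  virtually_abelian:
    "finite_index_abelian A G \<Longrightarrow> hirsch_value G (rat_rank (G\<lparr>carrier := A\<rparr>))"
| locally:
    "is_ea_class \<X> \<Longrightarrow> H \<in> locally_in \<X> \<Longrightarrow>
     (\<forall>F. subgroup F H \<and> H\<lparr>carrier := F\<rparr> \<in> \<X> \<longrightarrow> hirsch_value (H\<lparr>carrier := F\<rparr>) (h F)) \<Longrightarrow>
     hirsch_value H (SUP F\<in>{F. subgroup F H \<and> H\<lparr>carrier := F\<rparr> \<in> \<X>}. h F)"
| extension:
    "group G \<Longrightarrow> N \<lhd> G \<Longrightarrow> is_ea_class \<X> \<Longrightarrow> G\<lparr>carrier := N\<rparr> \<in> locally_in \<X> \<Longrightarrow>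
     hirsch_value (G\<lparr>carrier := N\<rparr>) m \<Longrightarrow> finite_index_abelian B (G Mod N) \<Longrightarrow>
     hirsch_value G (m + rat_rank ((G Mod N)\<lparr>carrier := B\<rparr>))"

text \<open>
  For an elementary amenable group the value exists and is unique (well-definedness of the Hirsch
  length), so the choice operator just picks out that value.
\<close>

definition hirsch_length :: "'a monoid \<Rightarrow> enat"
  where "hirsch_length G = (SOME n. hirsch_value G n)"

end

theory Submission
  imports Defs
begin

text \<open>
  Asymptotic dimension at most \<open>n\<close> is expressed without a metric: for every finite set \<open>F\<close> there is a
  partition of the group into cells at bounded distance from their labels such that every translate
  \<open>F x\<close> meets at most \<open>n + 1\<close> cells. This property passes to groups all of whose finitely generated
  subgroups have it and to overgroups of finite index, and an infinite cyclic extension raises \<open>n\<close> by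
  at most one, because one can interpolate along the cyclic direction between a fine and a much
  coarser partition of the kernel, alternately in both directions.

  In an extension with abelian quotient the generators are adjoined one at a time. Each one gives
  either a finite index or an infinite cyclic extension, and the generators of the second kind are
  linearly independent in the tensor product of the quotient with the rationals. Rule induction then
  bounds the dimension by every value that the clauses for the Hirsch length allow to compute, and
  transfinite induction along the hierarchy shows that such a value exists.
\<close>

section \<open>Coarse dimension of groups\<close>

text \<open>The cyclic extension is the delicate point. Where two partitions of the kernel meet,
  each showing up to \<open>m + 1\<close> cells, up to \<open>2 * m + 2\<close> cells could be seen,
  while only one extra cell is affordable. Colours resolve this: if points of equal colour in a
  small window share their label, the change from fine to coarse can be made at a different height
  for each colour, so that a window never sees two changes at once. Distances are measured by finite
  sets multiplying from the left, so right translations cost nothing. Hence one finite set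
  \<open>S\<close> serves all right cosets of a subgroup, and points at different heights of a
  cyclic extension can be compared inside the kernel. For the rational rank, formal sums are
  evaluated in the group after multiplication by a common denominator. This detects whether a tensor
  lies in the rational span of a subgroup, which is otherwise a matter of flatness of the
  rationals.\<close>

text \<open>
  For a right-invariant proper metric, \<open>F\<close> plays the role of a ball around the unit and \<open>p\<close> maps
  each point to a label at bounded distance; the cells are the fibres of \<open>p\<close>.
\<close>

definition coarse_partition ::
  "('a, 'b) monoid_scheme \<Rightarrow> 'a set \<Rightarrow> nat \<Rightarrow> 'a set \<Rightarrow> 'a set \<Rightarrow> ('a \<Rightarrow> 'a) \<Rightarrow> bool"
  where "coarse_partition G H n F S p \<longleftrightarrow> finite S \<and> S \<subseteq> H \<and>
    (\<forall>x\<in>H. p x \<in> H \<and> (\<exists>s\<in>S. x = s \<otimes>\<^bsub>G\<^esub> p x) \<and> card (p ` (\<lambda>f. f \<otimes>\<^bsub>G\<^esub> x) ` F) \<le> n + 1)"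

definition coarse_dim_le :: "('a, 'b) monoid_scheme \<Rightarrow> 'a set \<Rightarrow> nat \<Rightarrow> bool"
  where "coarse_dim_le G H n \<longleftrightarrow>
    (\<forall>F. finite F \<and> F \<subseteq> H \<longrightarrow> (\<exists>S p. coarse_partition G H n F S p))"

lemma coarse_partitionD:
  assumes "coarse_partition G H n F S p"
  shows "finite S" "S \<subseteq> H" "\<And>x. x \<in> H \<Longrightarrow> p x \<in> H"
    "\<And>x. x \<in> H \<Longrightarrow> \<exists>s\<in>S. x = s \<otimes>\<^bsub>G\<^esub> p x"
    "\<And>x. x \<in> H \<Longrightarrow> card (p ` (\<lambda>f. f \<otimes>\<^bsub>G\<^esub> x) ` F) \<le> n + 1"
  using assms by (auto simp: coarse_partition_def)

lemma coarse_dim_leE: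
  assumes "coarse_dim_le G H n" "finite F" "F \<subseteq> H"
  obtains S p where "coarse_partition G H n F S p"
  using assms by (auto simp: coarse_dim_le_def)

lemma coarse_dim_le_mono:
  assumes "coarse_dim_le G H m" "m \<le> n"
  shows "coarse_dim_le G H n"
proof -
  have "coarse_partition G H m F S p \<Longrightarrow> coarse_partition G H n F S p" for F S p
    using assms(2) unfolding coarse_partition_def by (meson add_le_mono1 order_trans)
  then show ?thesis
    using assms(1) unfolding coarse_dim_le_def by (elim all_forward imp_forward ex_forward)
qed

text \<open>Only the multiplication of the ambient group enters, so a bound for a subgroup regarded
  as a group of its own is a bound inside the large group.\<close>

lemma coarse_dim_le_carrier_update [simp]:
  "coarse_dim_le (G\<lparr>carrier := N\<rparr>) H n \<longleftrightarrow> coarse_dim_le G H n"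
  by (simp add: coarse_dim_le_def coarse_partition_def)

context group
begin

text \<open>A witness \<open>s\<close> must equal \<open>x \<otimes> inv (p x)\<close>, which lies
  in \<open>H\<close>. The finite set can therefore be assembled in the whole group and cut down to
  \<open>H\<close> afterwards.\<close>

lemma coarse_partitionI:
  assumes H: "subgroup H G" and S: "finite S" "S \<subseteq> carrier G"
    and p: "\<And>x. x \<in> H \<Longrightarrow> p x \<in> H" "\<And>x. x \<in> H \<Longrightarrow> \<exists>s\<in>S. x = s \<otimes> p x"
      "\<And>x. x \<in> H \<Longrightarrow> card (p ` (\<lambda>f. f \<otimes> x) ` F) \<le> n + 1"
  shows "coarse_partition G H n F (S \<inter> H) p"
proof -
  have "\<exists>s\<in>S \<inter> H. x = s \<otimes> p x" if x: "x \<in> H" for x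
  proof -
    obtain s where s: "s \<in> S" "x = s \<otimes> p x"
      using p(2)[OF x] by blast
    have c: "s \<in> carrier G" "p x \<in> carrier G"
      using s S p(1)[OF x] subgroup.subset[OF H] by auto
    have "x \<otimes> inv (p x) = (s \<otimes> p x) \<otimes> inv (p x)"
      using s(2) by simp
    also have "\<dots> = s"
      using c by (simp add: m_assoc)
    finally have "s \<in> H"
      using subgroup.m_closed[OF H x subgroup.m_inv_closed[OF H p(1)[OF x]]] by simp
    then show ?thesis
      using s by blast
  qed
  then show ?thesis
    unfolding coarse_partition_def using S p(1,3) by (intro conjI ballI) auto
qed

lemma coarse_dim_leI:
  assumes "\<And>F. finite F \<Longrightarrow> F \<subseteq> H \<Longrightarrow> \<exists>S p. coarse_partition G H n F S p"
  shows "coarse_dim_le G H n"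
  unfolding coarse_dim_le_def by (intro allI impI, elim conjE) (rule assms)

lemma coarse_dim_le_trivial: "coarse_dim_le G {\<one>} 0"
proof (rule coarse_dim_leI)
  fix F assume F: "finite F" "F \<subseteq> {\<one>}"
  have "card ((\<lambda>x. x) ` (\<lambda>f. f \<otimes> \<one>) ` F) \<le> card {\<one>}"
    using F by (intro card_mono) auto
  then show "\<exists>S p. coarse_partition G {\<one>} 0 F S p"
    by (intro exI[of _ "{\<one>}"] exI[of _ "\<lambda>x. x"]) (simp add: coarse_partition_def)
qed

section \<open>Local subgroups and finite index\<close>

text \<open>Left multiplication by \<open>K\<close> preserves each right coset of \<open>K\<close>,
  so a partition of \<open>K\<close> is copied onto every such coset in \<open>H\<close> by right
  translation with a representative. The set \<open>S\<close> is the same for all cosets, and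
  \<open>F\<close>, lying in \<open>K\<close>, never leads out of a coset.\<close>

lemma coarse_dim_le_local:
  assumes H: "subgroup H G"
    and loc: "\<And>F. finite F \<Longrightarrow> F \<subseteq> H \<Longrightarrow> \<exists>K. subgroup K G \<and> F \<subseteq> K \<and> K \<subseteq> H \<and> coarse_dim_le G K n"
  shows "coarse_dim_le G H n"
proof (rule coarse_dim_leI)
  fix F assume F: "finite F" "F \<subseteq> H"
  obtain K where K: "subgroup K G" "F \<subseteq> K" "K \<subseteq> H" "coarse_dim_le G K n"
    using loc[OF F] by blast
  interpret K: subgroup K G by (rule K)
  interpret H: subgroup H G by (rule H)
  obtain S p where "coarse_partition G K n F S p"
    using coarse_dim_leE[OF K(4) F(1) K(2)] .
  note S = coarse_partitionD(1,2)[OF this] and p = coarse_partitionD(3-)[OF this]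
  define r where "r x = (SOME y. y \<in> K #> x)" for x
  define k where "k x = x \<otimes> inv (r x)" for x
  have r: "r x \<in> K #> x" if "x \<in> H" for x
    unfolding r_def using H.mem_carrier[OF that] by (rule someI[of "\<lambda>y. y \<in> K #> x", OF rcos_self[OF _ K(1)]])
  have rH: "r x \<in> H" if "x \<in> H" for x
    using r[OF that] K(3) that H.m_closed by (auto simp: r_coset_def)
  have kK: "k x \<in> K" and xk: "x = k x \<otimes> r x" if "x \<in> H" for x
  proof -
    obtain a where a: "a \<in> K" "r x = a \<otimes> x"
      using r[OF \<open>x \<in> H\<close>] by (auto simp: r_coset_def)
    then show "k x \<in> K"
      using \<open>x \<in> H\<close> K.mem_carrier[of a] H.mem_carrier[of x]
      by (simp add: k_def inv_mult_group m_assoc[symmetric])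
    show "x = k x \<otimes> r x"
      using rH[OF that] that by (simp add: k_def m_assoc)
  qed
  have rf: "r (f \<otimes> x) = r x" if "x \<in> H" "f \<in> K" for x f
  proof -
    have "K #> (f \<otimes> x) = K #> x"
      using that K.rcos_const[of f] coset_mult_assoc[of K f x] K.subset
      by (metis H.mem_carrier K.mem_carrier is_group subgroup.rcos_const)
    then show ?thesis by (simp add: r_def)
  qed
  have kf: "k (f \<otimes> x) = f \<otimes> k x" if "x \<in> H" "f \<in> K" for x f
    using that rf[OF that] rH by (simp add: k_def m_assoc)
  have "coarse_partition G H n F (S \<inter> H) (\<lambda>x. p (k x) \<otimes> r x)"
  proof (rule coarse_partitionI[OF H])
    fix x assume x: "x \<in> H"
    show "p (k x) \<otimes> r x \<in> H"
      using p(1)[OF kK[OF x]] K(3) rH[OF x] by auto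
    obtain s where s: "s \<in> S" "k x = s \<otimes> p (k x)"
      using p(2)[OF kK[OF x]] by blast
    have "x = (s \<otimes> p (k x)) \<otimes> r x"
      using xk[OF x] s by simp
    also have "\<dots> = s \<otimes> (p (k x) \<otimes> r x)"
      using s S p(1)[OF kK[OF x]] rH[OF x] by (intro m_assoc) auto
    finally show "\<exists>s\<in>S. x = s \<otimes> (p (k x) \<otimes> r x)" using s by blast
    have "(\<lambda>x. p (k x) \<otimes> r x) ` (\<lambda>f. f \<otimes> x) ` F = (\<lambda>y. y \<otimes> r x) ` p ` (\<lambda>f. f \<otimes> k x) ` F"
      using K(2) kf[OF x] rf[OF x] by (auto simp: image_image subset_iff intro!: image_cong)
    also have "card \<dots> \<le> n + 1"
      using p(3)[OF kK[OF x]] F(1) by (metis card_image_le finite_imageI order_trans)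
    finally show "card ((\<lambda>x. p (k x) \<otimes> r x) ` (\<lambda>f. f \<otimes> x) ` F) \<le> n + 1" .
  qed (use S K.subset in auto)
  then show "\<exists>S p. coarse_partition G H n F S p" by blast
qed

text \<open>A point is labelled through its \<open>K\<close>-component, which is at bounded distance
  because \<open>T\<close> multiplies from the left. Passing from \<open>x\<close> to
  \<open>f \<otimes> x\<close> multiplies this component from the left by an element of a finite
  subset of \<open>K\<close>, and the partition of \<open>K\<close> is chosen for that
  subset.\<close>

lemma coarse_dim_le_finite_index:
  assumes H: "subgroup H G" and K: "subgroup K G" "K \<subseteq> H" and T: "finite T" "T \<subseteq> H"
    and dec: "\<And>x. x \<in> H \<Longrightarrow> \<exists>t\<in>T. \<exists>k\<in>K. x = t \<otimes> k"
    and dim: "coarse_dim_le G K n"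
  shows "coarse_dim_le G H n"
proof (rule coarse_dim_leI)
  fix F assume F: "finite F" "F \<subseteq> H"
  interpret K: subgroup K G by (rule K)
  interpret H: subgroup H G by (rule H)
  obtain \<tau> k where dec': "\<And>x. x \<in> H \<Longrightarrow> \<tau> x \<in> T \<and> k x \<in> K \<and> x = \<tau> x \<otimes> k x"
    using dec by metis
  define F' where "F' = K \<inter> (\<lambda>(a, f, b). inv a \<otimes> f \<otimes> b) ` (T \<times> F \<times> T)"
  have F': "finite F'" "F' \<subseteq> K"
    using F T by (auto simp: F'_def)
  obtain S p where "coarse_partition G K n F' S p"
    using coarse_dim_leE[OF dim F'] .
  note S = coarse_partitionD(1,2)[OF this] and p = coarse_partitionD(3-)[OF this]
  have kf: "\<exists>g\<in>F'. k (f \<otimes> x) = g \<otimes> k x" if x: "x \<in> H" and f: "f \<in> F" for x f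
  proof -
    have fx: "f \<otimes> x \<in> H" "f \<in> carrier G" using x f F by auto
    note d = dec'[OF x] dec'[OF fx(1)]
    have c: "\<tau> x \<in> carrier G" "\<tau> (f \<otimes> x) \<in> carrier G" "k x \<in> carrier G" "k (f \<otimes> x) \<in> carrier G"
      using d T K.subset H.subset by auto
    define g where "g = inv \<tau> (f \<otimes> x) \<otimes> f \<otimes> \<tau> x"
    have "g \<otimes> k x = inv \<tau> (f \<otimes> x) \<otimes> (f \<otimes> (\<tau> x \<otimes> k x))"
      using c fx by (simp add: g_def m_assoc)
    also have "\<dots> = inv \<tau> (f \<otimes> x) \<otimes> (\<tau> (f \<otimes> x) \<otimes> k (f \<otimes> x))"
      using d by simp
    also have "\<dots> = k (f \<otimes> x)"
      using c by (simp add: m_assoc[symmetric])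
    finally have *: "k (f \<otimes> x) = g \<otimes> k x" by simp
    then have "g = k (f \<otimes> x) \<otimes> inv (k x)"
      using c fx by (simp add: g_def m_assoc)
    then have "g \<in> K" using d by auto
    moreover have "g \<in> (\<lambda>(a, f, b). inv a \<otimes> f \<otimes> b) ` (T \<times> F \<times> T)"
      unfolding g_def using d f by (intro image_eqI[of _ _ "(\<tau> (f \<otimes> x), f, \<tau> x)"]) auto
    ultimately show ?thesis using * unfolding F'_def by blast
  qed
  have "coarse_partition G H n F ((\<lambda>(t, s). t \<otimes> s) ` (T \<times> S) \<inter> H) (\<lambda>x. p (k x))"
  proof (rule coarse_partitionI[OF H])
    show "finite ((\<lambda>(t, s). t \<otimes> s) ` (T \<times> S))" using T S by auto
    show "(\<lambda>(t, s). t \<otimes> s) ` (T \<times> S) \<subseteq> carrier G"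
      using T(2) S(2) H.subset K.subset by (auto intro!: m_closed)
    fix x assume x: "x \<in> H"
    note d = dec'[OF x]
    show "p (k x) \<in> H" using p(1) d K(2) by auto
    obtain s where s: "s \<in> S" "k x = s \<otimes> p (k x)"
      using p(2) d by blast
    have "x = \<tau> x \<otimes> (s \<otimes> p (k x))" using d s by simp
    also have "\<dots> = (\<tau> x \<otimes> s) \<otimes> p (k x)"
      using d s S T p(1)[of "k x"] by (intro m_assoc[symmetric]) auto
    finally show "\<exists>s\<in>(\<lambda>(t, s). t \<otimes> s) ` (T \<times> S). x = s \<otimes> p (k x)"
      using d s by (intro bexI[of _ "\<tau> x \<otimes> s"]) auto
    have "(\<lambda>x. p (k x)) ` (\<lambda>f. f \<otimes> x) ` F \<subseteq> p ` (\<lambda>f. f \<otimes> k x) ` F'"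
      using kf[OF x] by fastforce
    then have "card ((\<lambda>x. p (k x)) ` (\<lambda>f. f \<otimes> x) ` F) \<le> card (p ` (\<lambda>f. f \<otimes> k x) ` F')"
      using F' by (intro card_mono) auto
    then show "card ((\<lambda>x. p (k x)) ` (\<lambda>f. f \<otimes> x) ` F) \<le> n + 1"
      using p(3)[of "k x"] d by simp
  qed
  then show "\<exists>S p. coarse_partition G H n F S p" by blast
qed

end

section \<open>Infinite cyclic extensions\<close>

lemma card_image_le_colours:
  fixes c :: "'a \<Rightarrow> nat"
  assumes "finite Y" "\<And>y. y \<in> Y \<Longrightarrow> c y \<le> n"
    and "\<And>y z. y \<in> Y \<Longrightarrow> z \<in> Y \<Longrightarrow> c y = c z \<Longrightarrow> p y = p z"
  shows "card (p ` Y) \<le> n + 1"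
proof -
  have "p ` Y \<subseteq> (\<lambda>k. p (SOME y. y \<in> Y \<and> c y = k)) ` {..n}"
  proof
    fix v assume "v \<in> p ` Y"
    then obtain y where y: "y \<in> Y" "v = p y" by blast
    then have "(SOME z. z \<in> Y \<and> c z = c y) \<in> Y \<and> c (SOME z. z \<in> Y \<and> c z = c y) = c y"
      by (intro someI[of "\<lambda>z. z \<in> Y \<and> c z = c y" y]) simp
    then have "v = p (SOME z. z \<in> Y \<and> c z = c y)"
      using assms(3) y by metis
    then show "v \<in> (\<lambda>k. p (SOME y. y \<in> Y \<and> c y = k)) ` {..n}"
      using assms(2)[OF y(1)] by blast
  qed
  then have "card (p ` Y) \<le> card ((\<lambda>k. p (SOME y. y \<in> Y \<and> c y = k)) ` {..n})"
    by (rule card_mono[rotated]) simp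
  also have "\<dots> \<le> n + 1"
    using card_image_le[of "{..n}"] by simp
  finally show ?thesis .
qed

text \<open>Otherwise the \<open>n + 1\<close> double steps would all be strict, and from at least
  one element the set would grow to at least \<open>n + 2\<close>.\<close>

lemma ex_repeated_even_step:
  fixes E :: "nat \<Rightarrow> 'a set"
  assumes mono: "\<And>k. E k \<subseteq> E (Suc k)" and fin: "\<And>k. finite (E k)" and ne: "E 0 \<noteq> {}"
    and card: "card (E (2 * n + 2)) \<le> n + 1"
  shows "\<exists>i\<le>n. E (2 * i) = E (2 * i + 2)"
proof (rule ccontr)
  assume "\<not> ?thesis"
  then have neq: "E (2 * i) \<noteq> E (2 * i + 2)" if "i \<le> n" for i
    using that by blast
  have "i \<le> n + 1 \<Longrightarrow> i + 1 \<le> card (E (2 * i))" for i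
  proof (induction i)
    case 0
    then show ?case using ne fin[of 0] by (simp add: Suc_le_eq card_gt_0_iff)
  next
    case (Suc i)
    have "E (2 * i) \<subset> E (2 * i + 2)"
      using neq[of i] Suc.prems mono[of "2 * i"] mono[of "Suc (2 * i)"] by auto
    then have "card (E (2 * i)) < card (E (2 * i + 2))"
      using fin by (rule psubset_card_mono[rotated])
    then show ?case using Suc by simp
  qed
  from this[of "n + 1"] card show False by simp
qed

context group
begin

text \<open>
  Let \<open>E k x\<close> be the labels seen within \<open>k\<close> steps of \<open>x\<close>. At most \<open>n + 1\<close> labels are seen, so
  \<open>E (2 * i) x = E (2 * i + 2) x\<close> for some \<open>i \<le> n\<close>. For neighbours with such sets of equal cardinality,
  one of the sets is contained in the other, so they coincide: the cardinality is the colour.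
\<close>

lemma coarse_dim_le_colouring:
  assumes H: "subgroup H G" and dim: "coarse_dim_le G H n" and F: "finite F" "F \<subseteq> H"
  obtains S p and c :: "'a \<Rightarrow> nat" where "finite S" "S \<subseteq> H"
    "\<And>x. x \<in> H \<Longrightarrow> p x \<in> H" "\<And>x. x \<in> H \<Longrightarrow> \<exists>s\<in>S. x = s \<otimes> p x"
    "\<And>x. x \<in> H \<Longrightarrow> c x \<le> n"
    "\<And>x f g. x \<in> H \<Longrightarrow> f \<in> F \<Longrightarrow> g \<in> F \<Longrightarrow> c (f \<otimes> x) = c (g \<otimes> x) \<Longrightarrow> p (f \<otimes> x) = p (g \<otimes> x)"
proof -
  interpret H: subgroup H G by (rule H)
  \<comment> \<open>Two points \<open>f \<otimes> x\<close> and \<open>g \<otimes> x\<close> differ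
    by a left factor in \<open>A\<close>; the sets \<open>B k\<close> of \<open>k\<close>-fold
    products increase because \<open>A\<close> contains the unit.\<close>
  define A where "A = insert \<one> ((\<lambda>(f, g). f \<otimes> inv g) ` (F \<times> F))"
  have A: "finite A" "A \<subseteq> H" "\<one> \<in> A"
    using F by (auto simp: A_def)
  define B where "B = rec_nat {\<one>} (\<lambda>_ X. (\<lambda>(b, a). b \<otimes> a) ` (X \<times> A))"
  have B0: "B 0 = {\<one>}" and BS: "B (Suc k) = (\<lambda>(b, a). b \<otimes> a) ` (B k \<times> A)" for k
    by (simp_all add: B_def)
  have B: "finite (B k)" "B k \<subseteq> H" "B k \<noteq> {}" for k
    by (induction k) (use A in \<open>auto simp: B0 BS\<close>)
  have Bmono: "B k \<subseteq> B (Suc k)" for k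
  proof
    fix b assume "b \<in> B k"
    then show "b \<in> B (Suc k)"
      unfolding BS using A(3) B(2)[of k] by (intro image_eqI[of _ _ "(b, \<one>)"]) auto
  qed
  obtain S p where "coarse_partition G H n (B (2 * n + 2)) S p"
    using coarse_dim_leE[OF dim B(1) B(2)] .
  note S = coarse_partitionD(1,2)[OF this] and p = coarse_partitionD(3-)[OF this]
  define E where "E k x = p ` (\<lambda>b. b \<otimes> x) ` B k" for k x
  have Efin: "finite (E k x)" and Ene: "E k x \<noteq> {}" for k x
    using B by (auto simp: E_def)
  have ES: "E k x \<subseteq> E (Suc k) x" for k x
    unfolding E_def by (intro image_mono Bmono)
  have Emono: "E k x \<subseteq> E l x" if "k \<le> l" for k l x
    by (rule lift_Suc_mono_le[of "\<lambda>k. E k x", OF ES that])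
  have Eshift: "E k (a \<otimes> x) \<subseteq> E (Suc k) x" if "a \<in> A" "x \<in> H" for a k x
  proof -
    have "b \<otimes> (a \<otimes> x) = (b \<otimes> a) \<otimes> x" if "b \<in> B k" for b
      using that \<open>a \<in> A\<close> \<open>x \<in> H\<close> A(2) B(2)[of k] by (intro m_assoc[symmetric]) auto
    then show ?thesis
      using \<open>a \<in> A\<close> unfolding E_def BS by (force simp: image_image)
  qed
  have "\<exists>i\<le>n. E (2 * i) x = E (2 * i + 2) x" if "x \<in> H" for x
    by (rule ex_repeated_even_step[of "\<lambda>k. E k x", OF ES Efin Ene])
      (use p(3)[OF that] in \<open>simp add: E_def\<close>)
  then obtain i where i: "\<And>x. x \<in> H \<Longrightarrow> i x \<le> n \<and> E (2 * i x) x = E (2 * i x + 2) x"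
    by metis
  define \<sigma> where "\<sigma> x = E (2 * i x) x" for x
  \<comment> \<open>The sets \<open>\<sigma> x\<close> have between 1 and \<open>n + 1\<close>
    elements, so the colours run from 0 to \<open>n\<close>. The label \<open>q x\<close> is chosen
    from the set alone, so equal sets give equal labels.\<close>
  define c where "c x = card (\<sigma> x) - 1" for x
  define q where "q x = (SOME v. v \<in> \<sigma> x)" for x
  have \<sigma>fin: "finite (\<sigma> x)" and \<sigma>card: "card (\<sigma> x) > 0" for x
    using Efin Ene by (auto simp: \<sigma>_def card_gt_0_iff)
  have q: "q x \<in> \<sigma> x" for x
    unfolding q_def \<sigma>_def using Ene by (simp add: some_in_eq)
  have \<sigma>E: "\<sigma> x \<subseteq> E (2 * n + 2) x" if "x \<in> H" for x
    unfolding \<sigma>_def using i[OF that] by (intro Emono) simp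
  have \<sigma>_eq: "\<sigma> y = \<sigma> x" if le: "i y \<le> i x" and c: "c y = c x" and y: "y = a \<otimes> x" "a \<in> A" and x: "x \<in> H"
    for x y a
  proof (rule card_subset_eq[OF \<sigma>fin])
    have "\<sigma> y \<subseteq> E (Suc (2 * i y)) x"
      unfolding \<sigma>_def y(1) using Eshift[OF y(2) x] by (simp add: y(1))
    also have "\<dots> \<subseteq> E (2 * i x + 2) x"
      using le by (intro Emono) simp
    finally show "\<sigma> y \<subseteq> \<sigma> x"
      using i[OF x] by (simp add: \<sigma>_def)
    show "card (\<sigma> y) = card (\<sigma> x)"
      using c \<sigma>card[of x] \<sigma>card[of y] by (simp add: c_def)
  qed
  \<comment> \<open>The label \<open>q x\<close> was the \<open>p\<close>-label of some
    \<open>b \<otimes> x\<close>, and \<open>inv b\<close> leads back to \<open>x\<close>.\<close>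
  define S' where "S' = (\<lambda>(b, s). inv b \<otimes> s) ` (B (2 * n + 2) \<times> S)"
  show thesis
  proof (rule that[of S' q c])
    show "finite S'" using B S by (simp add: S'_def)
    show "S' \<subseteq> H" using B(2)[of "2 * n + 2"] S by (auto simp: S'_def)
    fix x assume x: "x \<in> H"
    obtain b where b: "b \<in> B (2 * n + 2)" "q x = p (b \<otimes> x)"
      using \<sigma>E[OF x] q[of x] by (auto simp: E_def)
    have bH: "b \<in> H" using b B by auto
    then have bx: "b \<otimes> x \<in> H" using x by auto
    show qH: "q x \<in> H" using p(1)[OF bx] b by simp
    obtain s where s: "s \<in> S" "b \<otimes> x = s \<otimes> q x"
      using p(2)[OF bx] b by auto
    have "x = inv b \<otimes> (b \<otimes> x)"
      using bH x by (simp add: m_assoc[symmetric])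
    also have "\<dots> = inv b \<otimes> s \<otimes> q x"
      unfolding s(2) using bH s S qH by (intro m_assoc[symmetric]) auto
    finally show "\<exists>s\<in>S'. x = s \<otimes> q x"
      using b(1) s(1) by (intro bexI[of _ "inv b \<otimes> s"]) (auto simp: S'_def)
    have "\<sigma> x \<subseteq> E (2 * n + 2) x" by (rule \<sigma>E[OF x])
    then have "card (\<sigma> x) \<le> card (E (2 * n + 2) x)"
      using Efin by (intro card_mono)
    then show "c x \<le> n"
      using p(3)[OF x] by (simp add: c_def E_def)
  next
    fix x f g assume x: "x \<in> H" and fg: "f \<in> F" "g \<in> F" and c: "c (f \<otimes> x) = c (g \<otimes> x)"
    have step: "g' \<otimes> x = (g' \<otimes> inv f') \<otimes> (f' \<otimes> x)" "g' \<otimes> inv f' \<in> A" "f' \<otimes> x \<in> H"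
      if fg': "f' \<in> F" "g' \<in> F" for f' g'
    proof -
      have "f' \<in> H" "g' \<in> H" using F fg' by auto
      then show "g' \<otimes> x = (g' \<otimes> inv f') \<otimes> (f' \<otimes> x)" "f' \<otimes> x \<in> H"
        using x by (simp_all add: m_assoc inv_solve_left)
      show "g' \<otimes> inv f' \<in> A" using fg' by (auto simp: A_def)
    qed
    have "\<sigma> (f \<otimes> x) = \<sigma> (g \<otimes> x)"
    proof (cases "i (f \<otimes> x) \<le> i (g \<otimes> x)")
      case True
      show ?thesis by (rule \<sigma>_eq[OF True c step[OF fg(2,1)]])
    next
      case False
      then have "i (g \<otimes> x) \<le> i (f \<otimes> x)" by simp
      from \<sigma>_eq[OF this c[symmetric] step[OF fg]] show ?thesis by simp
    qed
    then show "q (f \<otimes> x) = q (g \<otimes> x)" by (simp add: q_def)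
  qed
qed

section \<open>Interpolation between heights\<close>

lemma coarse_dim_le_int_extension:
  fixes \<pi> :: "'a \<Rightarrow> int"
  assumes K: "subgroup K G"
    and hom: "\<And>x y. x \<in> K \<Longrightarrow> y \<in> K \<Longrightarrow> \<pi> (x \<otimes> y) = \<pi> x + \<pi> y"
    and t: "t \<in> K" "\<pi> t = 1"
    and dim: "coarse_dim_le G {x \<in> K. \<pi> x = 0} m"
  shows "coarse_dim_le G K (m + 1)"
proof (rule coarse_dim_leI)
  fix F assume F: "finite F" "F \<subseteq> K"
  interpret K: subgroup K G by (rule K)
  have \<pi>_one: "\<pi> \<one> = 0"
    using hom[of \<one> \<one>] by simp
  have \<pi>_inv: "\<pi> (inv x) = - \<pi> x" if "x \<in> K" for x
    using hom[of x "inv x"] that \<pi>_one by simp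
  define M where "M = {x \<in> K. \<pi> x = 0}"
  have M: "subgroup M G"
    by (rule subgroupI) (auto simp: M_def hom \<pi>_one \<pi>_inv intro: exI[of _ \<one>])
  interpret M: subgroup M G by (rule M)
  define T where "T j = t [^] (j::int)" for j
  have T_K: "T j \<in> K" for j
    unfolding T_def by (rule subgroup_int_pow_closed[OF K t(1)])
  then have T_G [simp]: "T j \<in> carrier G" for j
    by auto
  have T_T: "T i \<otimes> T j = T (i + j)" for i j
    using t(1) by (simp add: T_def int_pow_mult)
  have T_T': "T i \<otimes> (T j \<otimes> x) = T (i + j) \<otimes> x" if "x \<in> carrier G" for i j x
    using that by (simp add: m_assoc[symmetric] T_T)
  have T_0 [simp]: "T 0 = \<one>"
    by (simp add: T_def)
  have \<pi>_T_nat: "\<pi> (T (int k)) = int k" for k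
  proof (induction k)
    case (Suc k)
    have "T (int (Suc k)) = T (int k) \<otimes> T 1"
      by (simp add: T_T add.commute)
    moreover have "T 1 = t"
      using t(1) by (simp add: T_def)
    ultimately show ?case
      using Suc hom[OF T_K T_K, of "int k" 1] t(2) by simp
  qed (simp add: \<pi>_one)
  have \<pi>_T [simp]: "\<pi> (T j) = j" for j
  proof (cases "j \<ge> 0")
    case True
    then show ?thesis using \<pi>_T_nat[of "nat j"] by simp
  next
    case False
    then show ?thesis
      using \<pi>_T_nat[of "nat (- j)"] hom[OF T_K T_K, of j "- j"] \<pi>_one by (simp add: T_T)
  qed
  \<comment> \<open>A power of \<open>t\<close> on the left moves \<open>x\<close> to height
    \<open>a\<close>, a bounded change as long as \<open>a\<close> is near \<open>\<pi> x\<close>;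
    the right translation then brings it into the kernel for free.\<close>
  define z where "z a x = T (a - \<pi> x) \<otimes> x \<otimes> T (- a)" for a x
  have z_M: "z a x \<in> M" if "x \<in> K" for a x
    using that T_K by (simp add: z_def M_def hom)

  define R where "R = Max (insert 0 ((\<lambda>f. \<bar>\<pi> f\<bar>) ` F))"
  have R: "R \<ge> 0" "\<And>f. f \<in> F \<Longrightarrow> \<bar>\<pi> f\<bar> \<le> R"
    using F(1) by (auto simp: R_def intro: Max_ge)
  \<comment> \<open>Two points of one translate of \<open>F\<close> differ in height by at most
    \<open>2 * R\<close>, less than \<open>W\<close>.\<close>
  define W where "W = 2 * R + 1"
  \<comment> \<open>The thresholds of the \<open>m + 1\<close> colours lie at distances up to
    \<open>(m + 1) * W\<close> from a fine height; this \<open>L\<close> keeps them more than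
    \<open>2 * R\<close> away from the coarse heights.\<close>
  define L where "L = (int m + 3) * W"
  have W: "W > 0" using R by (simp add: W_def)
  have L: "L \<ge> 3 * W" "L > 0"
    using W by (simp_all add: L_def mult_right_mono)
  \<comment> \<open>A generous range for the exponents of \<open>t\<close> that occur, making
    \<open>F1\<close>, \<open>F2\<close> and \<open>S\<close> finite.\<close>
  define J where "J = {- 3 * L .. 3 * L}"
  have J: "finite J" by (simp add: J_def)

  define F1 where "F1 = M \<inter> (\<lambda>(i, f, j). T i \<otimes> f \<otimes> T j) ` (J \<times> F \<times> J)"
  have F1: "finite F1" "F1 \<subseteq> M"
    using F J by (auto simp: F1_def)
  obtain S1 P and c :: "'a \<Rightarrow> nat" where S1: "finite S1" "S1 \<subseteq> M"
    and P: "\<And>x. x \<in> M \<Longrightarrow> P x \<in> M" "\<And>x. x \<in> M \<Longrightarrow> \<exists>s\<in>S1. x = s \<otimes> P x"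
    and c: "\<And>x. x \<in> M \<Longrightarrow> c x \<le> m"
    and Pc: "\<And>x f g. x \<in> M \<Longrightarrow> f \<in> F1 \<Longrightarrow> g \<in> F1 \<Longrightarrow> c (f \<otimes> x) = c (g \<otimes> x) \<Longrightarrow> P (f \<otimes> x) = P (g \<otimes> x)"
    using coarse_dim_le_colouring[OF M dim[folded M_def] F1] by blast
  \<comment> \<open>\<open>Q\<close> has to tolerate the displacement \<open>s\<close> between a
    point and its fine label in addition to \<open>F\<close>; in this sense it is the coarser
    partition.\<close>
  define F2 where
    "F2 = M \<inter> (\<lambda>(i, s, j, f, k). T i \<otimes> inv s \<otimes> T j \<otimes> f \<otimes> T k) ` (J \<times> S1 \<times> J \<times> F \<times> J)"
  have F2: "finite F2" "F2 \<subseteq> M"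
    using F J S1 by (auto simp: F2_def)
  obtain S2 Q where "coarse_partition G M m F2 S2 Q"
    using coarse_dim_leE[OF dim[folded M_def] F2] .
  note S2 = coarse_partitionD(1,2)[OF this] and Q = coarse_partitionD(3-)[OF this]

  \<comment> \<open>Heights \<open>2 * L * k\<close> carry the fine partition \<open>P\<close>, heights \<open>(2 * k + 1) * L\<close> the coarse partition \<open>Q\<close>.
    Moving away from a fine height, the cells of colour \<open>i\<close> are merged into coarse cells at distance
    \<open>(i + 1) * W\<close>; as a window of size \<open>2 * R\<close> sees at most one colour change, only one cell is added.\<close>
  define a where "a x = 2 * L * ((\<pi> x + L) div (2 * L))" for x
  define d where "d x = \<pi> x - a x" for x
  define b where "b x = (if d x \<ge> 0 then a x + L else a x - L)" for x
  define u where "u x = P (z (a x) x) \<otimes> T (a x)" for x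
  \<comment> \<open>The coarse label is computed from \<open>u x\<close> and not from
    \<open>x\<close>, so that points with the same fine label and the same target height
    \<open>b x\<close> are never separated.\<close>
  define w where "w x = z (b x) (u x)" for x
  define col where "col x = c (z (a x) x)" for x
  define fine where "fine x \<longleftrightarrow> \<bar>d x\<bar> \<le> (int (col x) + 1) * W" for x
  define p where "p x = (if fine x then u x else Q (w x) \<otimes> T (b x))" for x

  have d: "- L \<le> d x" "d x < L" for x
  proof -
    have "d x + L = (\<pi> x + L) mod (2 * L)"
      by (simp add: d_def a_def minus_mult_div_eq_mod[symmetric])
    then show "- L \<le> d x" "d x < L"
      using pos_mod_sign[of "2 * L" "\<pi> x + L"] pos_mod_bound[of "2 * L" "\<pi> x + L"] L by linarith+
  qed
  have div_eq: "(r + 2 * L * k) div (2 * L) = k" if "0 \<le> r" "r < 2 * L" for r k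
    using that L by (subst div_mult_self2) auto
  have u_K: "u x \<in> K" and \<pi>_u: "\<pi> (u x) = a x" if "x \<in> K" for x
    using P(1)[OF z_M[OF that]] T_K by (auto simp: u_def M_def hom)
  have w_M: "w x \<in> M" if "x \<in> K" for x
    unfolding w_def by (rule z_M[OF u_K[OF that]])
  have p_K: "p x \<in> K" if "x \<in> K" for x
    using u_K[OF that] Q(1)[OF w_M[OF that]] T_K by (auto simp: p_def M_def)
  have xu: "\<exists>s\<in>S1. x = T (d x) \<otimes> s \<otimes> u x" if x: "x \<in> K" for x
  proof -
    obtain s where s: "s \<in> S1" "z (a x) x = s \<otimes> P (z (a x) x)"
      using P(2)[OF z_M[OF x]] by blast
    have sG: "s \<in> carrier G" using s S1 by auto
    have PG: "P (z (a x) x) \<in> carrier G" using P(1)[OF z_M[OF x]] by auto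
    have "x = T (d x) \<otimes> z (a x) x \<otimes> T (a x)"
      using x by (simp add: z_def d_def m_assoc T_T T_T')
    also have "\<dots> = T (d x) \<otimes> s \<otimes> u x"
      by (subst s(2)) (simp add: u_def m_assoc sG PG)
    finally show ?thesis using s by blast
  qed
  have uw: "u x = T (a x - b x) \<otimes> w x \<otimes> T (b x)" if x: "x \<in> K" for x
    using u_K[OF x] by (simp add: w_def z_def \<pi>_u[OF x] m_assoc T_T T_T')
  have ab: "\<bar>a x - b x\<bar> = L" for x
    using L by (simp add: b_def)

  define S where "S = (\<lambda>(i, s). T i \<otimes> s) ` (J \<times> S1) \<union>
    (\<lambda>(i, s, j, s'). T i \<otimes> s \<otimes> T j \<otimes> s') ` (J \<times> S1 \<times> J \<times> S2)"
  have "coarse_partition G K (m + 1) F (S \<inter> K) p"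
  proof (rule coarse_partitionI[OF K])
    show "finite S" using J S1 S2 by (simp add: S_def)
    show "S \<subseteq> carrier G" using S1(2) S2(2) M.subset by (auto simp: S_def intro!: m_closed)
    fix x assume x: "x \<in> K"
    show "p x \<in> K" by (rule p_K[OF x])
    show "\<exists>s\<in>S. x = s \<otimes> p x"
    proof -
      obtain s where s: "s \<in> S1" "x = T (d x) \<otimes> s \<otimes> u x"
        using xu[OF x] by blast
      have dJ: "d x \<in> J" "a x - b x \<in> J"
        using d[of x] L unfolding J_def atLeastAtMost_iff by (linarith, smt ab)
      show ?thesis
      proof (cases "fine x")
        case True
        have "T (d x) \<otimes> s \<in> S"
          using s(1) dJ unfolding S_def by (intro UnI1 image_eqI[of _ _ "(d x, s)"]) auto
        then show ?thesis using s(2) True by (auto simp: p_def)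
      next
        case False
        obtain s' where s': "s' \<in> S2" "w x = s' \<otimes> Q (w x)"
          using Q(2)[OF w_M[OF x]] by blast
        have cG: "s \<in> carrier G" "s' \<in> carrier G" "Q (w x) \<in> carrier G"
          using s(1) s'(1) S1(2) S2(2) Q(1)[OF w_M[OF x]] by auto
        have "u x = T (a x - b x) \<otimes> (s' \<otimes> Q (w x)) \<otimes> T (b x)"
          using uw[OF x] s'(2) by simp
        then have "x = T (d x) \<otimes> s \<otimes> (T (a x - b x) \<otimes> (s' \<otimes> Q (w x)) \<otimes> T (b x))"
          using s(2) by simp
        also have "\<dots> = (T (d x) \<otimes> s \<otimes> T (a x - b x) \<otimes> s') \<otimes> p x"
          using False cG by (simp add: p_def m_assoc)
        finally have "x = (T (d x) \<otimes> s \<otimes> T (a x - b x) \<otimes> s') \<otimes> p x" .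
        moreover have "T (d x) \<otimes> s \<otimes> T (a x - b x) \<otimes> s' \<in> S"
          using s(1) s'(1) dJ unfolding S_def
          by (intro UnI2 image_eqI[of _ _ "(d x, s, a x - b x, s')"]) auto
        ultimately show ?thesis by blast
      qed
    qed
    have y_K: "f \<otimes> x \<in> K" if "f \<in> F" for f
      using that F x by auto
    have \<pi>_y: "\<pi> (f \<otimes> x) = \<pi> f + \<pi> x" if "f \<in> F" for f
      using that F x by (auto intro: hom)
    show "card (p ` (\<lambda>f. f \<otimes> x) ` F) \<le> m + 1 + 1"
    proof (cases "\<exists>k. \<bar>\<pi> x - (2 * k + 1) * L\<bar> \<le> R")
      case True
      then obtain k where k: "\<bar>\<pi> x - (2 * k + 1) * L\<bar> \<le> R" by blast
      define v where "v = (2 * k + 1) * L"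
      \<comment> \<open>Around a coarse height the nearest fine height may change within the
        translate, but every point is beyond the threshold of its colour and is sent to the same
        height \<open>v\<close>, so only cells of \<open>Q\<close> are seen.\<close>
      have y: "b (f \<otimes> x) = v \<and> \<not> fine (f \<otimes> x)" if f: "f \<in> F" for f
      proof -
        define y where "y = f \<otimes> x"
        define e where "e = \<pi> y - v"
        have e: "\<bar>e\<bar> \<le> 2 * R" "2 * R < L"
          using k R(2)[OF f] \<pi>_y[OF f] L R(1) by (auto simp: e_def v_def y_def W_def)
        have \<pi>y: "\<pi> y + L = e + (2 * L) * (k + 1)"
          by (simp add: e_def v_def algebra_simps)
        have dby: "\<bar>d y\<bar> \<ge> L - 2 * R \<and> b y = v"
        proof (cases "e \<ge> 0")
          case True
          have "(\<pi> y + L) div (2 * L) = k + 1"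
            unfolding \<pi>y using e True by (intro div_eq) auto
          then have "a y = v + L"
            by (simp add: a_def v_def algebra_simps)
          then show ?thesis using e by (auto simp: d_def b_def e_def)
        next
          case False
          have "\<pi> y + L = (2 * L + e) + (2 * L) * k"
            using \<pi>y by (simp add: algebra_simps)
          then have "(\<pi> y + L) div (2 * L) = k"
            using e False by (simp only:) (rule div_eq, auto)
          then have "a y = v - L"
            by (simp add: a_def v_def algebra_simps)
          then show ?thesis using e by (auto simp: d_def b_def e_def)
        qed
        have "int (col y) \<le> int m"
          using c[OF z_M[OF y_K[OF f]]] by (simp add: col_def y_def)
        then have "(int (col y) + 1) * W \<le> (int m + 1) * W"
          using W by (intro mult_right_mono) auto
        also have "\<dots> < L - 2 * R"
          using R(1) by (simp add: L_def W_def algebra_simps)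
        finally show ?thesis using dby by (auto simp: fine_def y_def)
      qed
      have "p (f \<otimes> x) \<in> (\<lambda>q. q \<otimes> T v) ` Q ` (\<lambda>g. g \<otimes> z v x) ` F2" if f: "f \<in> F" for f
      proof -
        define y where "y = f \<otimes> x"
        have yK: "y \<in> K" using y_K[OF f] by (simp add: y_def)
        obtain s where s: "s \<in> S1" "y = T (d y) \<otimes> s \<otimes> u y"
          using xu[OF yK] by blast
        have cG: "s \<in> carrier G" "f \<in> carrier G" "x \<in> carrier G" "u y \<in> carrier G"
          using s(1) S1(2) f F(2) x u_K[OF yK] by auto
        have sK: "s \<in> K" using s(1) S1(2) by (auto simp: M_def)
        have b_y: "b y = v" and py: "p y = Q (w y) \<otimes> T v"
          using y[OF f] by (auto simp: p_def y_def)
        have "inv s \<otimes> T (- d y) \<otimes> y = inv s \<otimes> T (- d y) \<otimes> (T (d y) \<otimes> s \<otimes> u y)"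
          using s(2) by simp
        also have "\<dots> = u y"
          using cG by (simp add: m_assoc T_T T_T') (simp add: m_assoc[symmetric])
        finally have u: "u y = inv s \<otimes> T (- d y) \<otimes> (f \<otimes> x)"
          by (simp add: y_def)
        define g where "g = T (v - a y) \<otimes> inv s \<otimes> T (- d y) \<otimes> f \<otimes> T (\<pi> x - v)"
        have "w y = T (v - a y) \<otimes> u y \<otimes> T (- v)"
          by (simp add: w_def b_y z_def \<pi>_u[OF yK])
        also have "\<dots> = g \<otimes> z v x"
          unfolding u g_def z_def using cG by (simp add: m_assoc T_T T_T')
        finally have wy: "w y = g \<otimes> z v x" .
        have "g \<in> K"
          using sK T_K f F by (auto simp: g_def)
        moreover have "\<pi> (g \<otimes> z v x) = 0"
          using w_M[OF yK] wy by (simp add: M_def)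
        ultimately have gM: "g \<in> M"
          using z_M[OF x, of v] by (auto simp: M_def hom)
        have "\<bar>\<pi> x - v\<bar> \<le> 3 * L" "\<bar>v - a y\<bar> \<le> 3 * L" "\<bar>d y\<bar> \<le> 3 * L"
          using k L R(1) ab[of y] d[of y] by (auto simp: b_y v_def W_def)
        then have "\<pi> x - v \<in> J" "v - a y \<in> J" "- d y \<in> J"
          by (auto simp: J_def)
        then have "g \<in> F2"
          unfolding F2_def using gM s(1) f
          by (intro IntI image_eqI[of _ _ "(v - a y, s, - d y, f, \<pi> x - v)"]) (auto simp: g_def)
        then show ?thesis
          using py wy by (auto simp: y_def)
      qed
      then have "p ` (\<lambda>f. f \<otimes> x) ` F \<subseteq> (\<lambda>q. q \<otimes> T v) ` Q ` (\<lambda>g. g \<otimes> z v x) ` F2"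
        by blast
      then have "card (p ` (\<lambda>f. f \<otimes> x) ` F) \<le> card ((\<lambda>q. q \<otimes> T v) ` Q ` (\<lambda>g. g \<otimes> z v x) ` F2)"
        using F2 by (intro card_mono) auto
      also have "\<dots> \<le> card (Q ` (\<lambda>g. g \<otimes> z v x) ` F2)"
        using F2 by (intro card_image_le) auto
      also have "\<dots> \<le> m + 1"
        by (rule Q(3)[OF z_M[OF x]])
      finally show ?thesis by simp
    next
      case False
      have far: "\<bar>\<pi> x - (2 * k + 1) * L\<bar> > R" for k
        using False by (simp add: not_le)
      define k where "k = (\<pi> x + L) div (2 * L)"
      have ax: "a x = 2 * L * k"
        by (simp add: a_def k_def)
      have "\<bar>d x - L\<bar> > R" "\<bar>d x + L\<bar> > R"
        using far[of k] far[of "k - 1"] by (simp_all add: d_def ax algebra_simps)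
      then have dx: "- L + R < d x" "d x < L - R"
        using d[of x] by linarith+
      have ay: "a (f \<otimes> x) = a x" and dy: "\<bar>d (f \<otimes> x) - d x\<bar> \<le> R" if f: "f \<in> F" for f
      proof -
        have e: "\<bar>\<pi> f\<bar> \<le> R" by (rule R(2)[OF f])
        have "\<pi> (f \<otimes> x) + L = (d x + \<pi> f + L) + (2 * L) * k"
          using \<pi>_y[OF f] by (simp add: d_def ax algebra_simps)
        then have "(\<pi> (f \<otimes> x) + L) div (2 * L) = k"
          using dx e by (simp only:) (rule div_eq, auto)
        then show *: "a (f \<otimes> x) = a x"
          by (simp add: a_def k_def)
        show "\<bar>d (f \<otimes> x) - d x\<bar> \<le> R"
          using e \<pi>_y[OF f] by (simp add: d_def *)
      qed
      \<comment> \<open>A point in the coarse regime is more than \<open>2 * R\<close> away from the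
        fine height, so moving by at most \<open>R\<close> does not change the side.\<close>
      have b_y: "b (f \<otimes> x) = b x" if f: "f \<in> F" and nf: "\<not> fine (f \<otimes> x)" for f
      proof -
        have "1 * W \<le> (int (col (f \<otimes> x)) + 1) * W"
          using W by (intro mult_right_mono) auto
        then have "\<bar>d (f \<otimes> x)\<bar> > 2 * R"
          using nf by (simp add: fine_def W_def)
        then show ?thesis
          using dy[OF f] ay[OF f] R(1) by (auto simp: b_def)
      qed
      have zy: "\<exists>g\<in>F1. z (a x) (f \<otimes> x) = g \<otimes> z (a x) x" if f: "f \<in> F" for f
      proof -
        define g where "g = T (a x - \<pi> (f \<otimes> x)) \<otimes> f \<otimes> T (\<pi> x - a x)"
        have cG: "f \<in> carrier G" "x \<in> carrier G" using f F(2) x by auto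
        have *: "z (a x) (f \<otimes> x) = g \<otimes> z (a x) x"
          unfolding z_def g_def using cG by (simp add: m_assoc T_T T_T')
        have "g \<in> M"
          using f F(2) T_K \<pi>_y[OF f] by (auto simp: g_def M_def hom)
        moreover have "a x - \<pi> (f \<otimes> x) = - d (f \<otimes> x)" "\<pi> x - a x = d x"
          using ay[OF f] by (simp_all add: d_def)
        then have "a x - \<pi> (f \<otimes> x) \<in> J" "\<pi> x - a x \<in> J"
          using d[of "f \<otimes> x"] d[of x] L by (simp_all add: J_def)
        ultimately have "g \<in> F1"
          unfolding F1_def using f
          by (intro IntI image_eqI[of _ _ "(a x - \<pi> (f \<otimes> x), f, \<pi> x - a x)"]) (auto simp: g_def)
        then show ?thesis using * by blast
      qed
      have u_eq: "u (f \<otimes> x) = u (g \<otimes> x)"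
        if fg: "f \<in> F" "g \<in> F" and cc: "col (f \<otimes> x) = col (g \<otimes> x)" for f g
      proof -
        obtain f' g' where fg': "f' \<in> F1" "g' \<in> F1" "z (a x) (f \<otimes> x) = f' \<otimes> z (a x) x"
          "z (a x) (g \<otimes> x) = g' \<otimes> z (a x) x"
          using zy[OF fg(1)] zy[OF fg(2)] by blast
        then have "P (f' \<otimes> z (a x) x) = P (g' \<otimes> z (a x) x)"
          using cc by (intro Pc[OF z_M[OF x]]) (simp_all add: col_def ay fg)
        then show ?thesis
          by (simp add: u_def ay fg fg')
      qed
      \<comment> \<open>The extra cell is accounted for here: raising the colour by one in the fine
        regime leaves \<open>m + 2\<close> possible values.\<close>
      define e where "e y = col y + (if fine y then 1 else 0)" for y
      \<comment> \<open>Equal \<open>e\<close> in different regimes means consecutive colours. The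
        distances of the two points from the fine height would then be separated by a gap of width
        \<open>W\<close>, more than a translate can span.\<close>
      have step: False
        if fg: "f \<in> F" "g \<in> F" and "fine (f \<otimes> x)" "\<not> fine (g \<otimes> x)"
          and "col (f \<otimes> x) + 1 = col (g \<otimes> x)" for f g
      proof -
        have "\<bar>d (f \<otimes> x)\<bar> \<le> (int (col (f \<otimes> x)) + 1) * W"
          "\<bar>d (g \<otimes> x)\<bar> > (int (col (f \<otimes> x)) + 1) * W + W"
          using that(3,4) by (simp_all add: fine_def that(5)[symmetric] algebra_simps)
        then show False
          using dy[OF fg(1)] dy[OF fg(2)] by (simp add: W_def)
      qed
      show ?thesis
      proof (rule card_image_le_colours[where c = e])
        show "finite ((\<lambda>f. f \<otimes> x) ` F)" using F by simp
        show "e y \<le> m + 1" if "y \<in> (\<lambda>f. f \<otimes> x) ` F" for y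
          using that c[OF z_M[OF y_K]] by (auto simp: e_def col_def intro: le_SucI)
        show "p y = p y'" if yy: "y \<in> (\<lambda>f. f \<otimes> x) ` F" "y' \<in> (\<lambda>f. f \<otimes> x) ` F" and ee: "e y = e y'" for y y'
        proof -
          obtain f g where fg: "f \<in> F" "g \<in> F" "y = f \<otimes> x" "y' = g \<otimes> x"
            using yy by blast
          have fine_eq: "fine y \<longleftrightarrow> fine y'"
            using step[OF fg(1,2)] step[OF fg(2,1)] ee by (auto simp: e_def fg split: if_splits)
          then have cc: "col (f \<otimes> x) = col (g \<otimes> x)"
            using ee by (auto simp: e_def fg)
          have uu: "u y = u y'"
            using u_eq[OF fg(1,2) cc] by (simp add: fg)
          show ?thesis
          proof (cases "fine y")
            case True
            then show ?thesis using fine_eq uu by (simp add: p_def)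
          next
            case nf: False
            then have "b y = b y'"
              using b_y[OF fg(1)] b_y[OF fg(2)] fine_eq by (simp add: fg)
            then show ?thesis using nf fine_eq uu by (simp add: p_def w_def)
          qed
        qed
      qed
    qed
  qed
  then show "\<exists>S p. coarse_partition G K (m + 1) F S p" by blast
qed

end

section \<open>Abelian extensions\<close>

definition adjoin :: "('a, 'b) monoid_scheme \<Rightarrow> 'a \<Rightarrow> 'a set \<Rightarrow> 'a set"
  where "adjoin G c K = {c [^]\<^bsub>G\<^esub> (j::int) \<otimes>\<^bsub>G\<^esub> x |j x. x \<in> K}"

primrec adjoin_list :: "('a, 'b) monoid_scheme \<Rightarrow> 'a set \<Rightarrow> 'a list \<Rightarrow> 'a set" where
  "adjoin_list G N [] = N"
| "adjoin_list G N (c # cs) = adjoin G c (adjoin_list G N cs)"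

text \<open>When \<open>N\<close> contains all commutators, this is linear independence over the
  integers modulo \<open>N\<close>, tested one entry at a time against the entries behind
  it.\<close>

primrec indep_over :: "('a, 'b) monoid_scheme \<Rightarrow> 'a set \<Rightarrow> 'a list \<Rightarrow> bool" where
  "indep_over G N [] \<longleftrightarrow> True"
| "indep_over G N (c # cs) \<longleftrightarrow>
     indep_over G N cs \<and> (\<forall>k::nat. k > 0 \<longrightarrow> c [^]\<^bsub>G\<^esub> k \<notin> adjoin_list G N cs)"

lemma adjoinI: "x \<in> K \<Longrightarrow> c [^]\<^bsub>G\<^esub> (j::int) \<otimes>\<^bsub>G\<^esub> x \<in> adjoin G c K"
  by (auto simp: adjoin_def)

lemma adjoinE:
  assumes "a \<in> adjoin G c K"
  obtains j :: int and x where "x \<in> K" "a = c [^]\<^bsub>G\<^esub> j \<otimes>\<^bsub>G\<^esub> x"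
  using assms by (auto simp: adjoin_def)

lemma adjoin_mono: "K \<subseteq> L \<Longrightarrow> adjoin G c K \<subseteq> adjoin G c L"
  by (auto simp: adjoin_def)

context group
begin

lemma adjoin_superset:
  assumes "subgroup K G" "c \<in> carrier G"
  shows "K \<subseteq> adjoin G c K" "c \<in> adjoin G c K"
proof -
  interpret K: subgroup K G by fact
  show "K \<subseteq> adjoin G c K"
  proof
    fix x assume "x \<in> K"
    then show "x \<in> adjoin G c K" using adjoinI[of x K G c 0] by simp
  qed
  show "c \<in> adjoin G c K"
    using adjoinI[of \<one> K G c 1] assms(2) by simp
qed

lemma adjoin_subset:
  assumes "subgroup H G" "K \<subseteq> H" "c \<in> H"
  shows "adjoin G c K \<subseteq> H"
proof -
  interpret H: subgroup H G by fact
  show ?thesis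
    using assms subgroup_int_pow_closed[OF assms(1,3)] by (auto simp: adjoin_def)
qed

text \<open>Powers of \<open>c\<close> normalise \<open>K\<close>, so they can be moved to the left
  past elements of \<open>K\<close>, at the price of conjugating these.\<close>

lemma subgroup_adjoin:
  assumes K: "subgroup K G" and c: "c \<in> carrier G"
    and nrm: "\<And>(j::int) x. x \<in> K \<Longrightarrow> c [^] j \<otimes> x \<otimes> c [^] (- j) \<in> K"
  shows "subgroup (adjoin G c K) G"
proof -
  interpret K: subgroup K G by fact
  let ?T = "\<lambda>j::int. c [^] j"
  have T: "?T j \<in> carrier G" for j using c by simp
  have TT: "?T i \<otimes> (?T j \<otimes> x) = ?T (i + j) \<otimes> x" if "x \<in> carrier G" for i j x
    using that c by (simp add: m_assoc[symmetric] int_pow_mult)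
  show ?thesis
  proof (rule subgroupI)
    show "adjoin G c K \<subseteq> carrier G"
      using T by (auto simp: adjoin_def)
    show "adjoin G c K \<noteq> {}"
      using adjoin_superset[OF K c] by auto
  next
    fix a assume "a \<in> adjoin G c K"
    then obtain j x where a: "a = ?T j \<otimes> x" "x \<in> K" by (auto simp: adjoin_def)
    have "inv a = ?T (- j) \<otimes> (?T j \<otimes> inv x \<otimes> ?T (- j))"
      using a c by (simp add: inv_mult_group int_pow_neg m_assoc TT)
        (simp add: m_assoc[symmetric])
    then show "inv a \<in> adjoin G c K"
      using nrm[of "inv x" j] a adjoinI[of "?T j \<otimes> inv x \<otimes> ?T (- j)" K G c "- j"] by simp
  next
    fix a b assume "a \<in> adjoin G c K" "b \<in> adjoin G c K"
    then obtain i x j y where ab: "a = ?T i \<otimes> x" "x \<in> K" "b = ?T j \<otimes> y" "y \<in> K"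
      by (auto simp: adjoin_def)
    have "?T j \<otimes> (?T (- j) \<otimes> x \<otimes> ?T j) = x \<otimes> ?T j"
      using ab c by (simp add: m_assoc TT)
    then have "a \<otimes> b = ?T i \<otimes> (?T j \<otimes> (?T (- j) \<otimes> x \<otimes> ?T j)) \<otimes> y"
      using ab T by (simp add: m_assoc)
    also have "\<dots> = ?T (i + j) \<otimes> ((?T (- j) \<otimes> x \<otimes> ?T j) \<otimes> y)"
      using ab T by (simp add: m_assoc TT)
    finally show "a \<otimes> b \<in> adjoin G c K"
      using nrm[of x "- j"] ab adjoinI[of "?T (- j) \<otimes> x \<otimes> ?T j \<otimes> y" K G c "i + j"] by simp
  qed
qed

text \<open>Division of exponents by \<open>k\<close> with remainder: the powers of \<open>c\<close>
  with exponents below \<open>k\<close> represent all cosets.\<close>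

lemma coarse_dim_le_adjoin_torsion:
  assumes K: "subgroup K G" and c: "c \<in> carrier G"
    and nrm: "\<And>(j::int) x. x \<in> K \<Longrightarrow> c [^] j \<otimes> x \<otimes> c [^] (- j) \<in> K"
    and k: "k > 0" "c [^] (k::nat) \<in> K" and dim: "coarse_dim_le G K n"
  shows "coarse_dim_le G (adjoin G c K) n"
proof (rule coarse_dim_le_finite_index[OF subgroup_adjoin[OF K c nrm] K adjoin_superset(1)[OF K c]])
  interpret K: subgroup K G by fact
  define T where "T = (\<lambda>j::int. c [^] j) ` {0..<int k}"
  show "finite T" by (simp add: T_def)
  show "T \<subseteq> adjoin G c K"
    unfolding T_def using c adjoinI[of \<one> K G c] by auto
  show "coarse_dim_le G K n" by fact
  fix x assume "x \<in> adjoin G c K"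
  then obtain j y where x: "x = c [^] (j::int) \<otimes> y" "y \<in> K" by (auto simp: adjoin_def)
  have "c [^] (int k * (j div int k)) = (c [^] int k) [^] (j div int k)"
    using c by (simp add: int_pow_pow)
  also have "\<dots> \<in> K"
    by (rule subgroup_int_pow_closed[OF K]) (simp add: int_pow_int k(2))
  finally have *: "c [^] (int k * (j div int k)) \<otimes> y \<in> K"
    using x by simp
  have "c [^] j = c [^] (j mod int k) \<otimes> c [^] (int k * (j div int k))"
    using c by (simp add: int_pow_mult[symmetric])
  then have "x = c [^] (j mod int k) \<otimes> (c [^] (int k * (j div int k)) \<otimes> y)"
    using x c by (simp add: m_assoc)
  moreover have "c [^] (j mod int k) \<in> T"
    using k(1) by (simp add: T_def)
  ultimately show "\<exists>t\<in>T. \<exists>k\<in>K. x = t \<otimes> k"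
    using * by blast
qed

text \<open>The exponent of \<open>c\<close> is uniquely determined since no positive power lies in
  \<open>K\<close>, and additive since \<open>K\<close> is normalised; it is the required
  homomorphism to the integers, with kernel \<open>K\<close>.\<close>

lemma coarse_dim_le_adjoin_free:
  assumes K: "subgroup K G" and c: "c \<in> carrier G"
    and nrm: "\<And>(j::int) x. x \<in> K \<Longrightarrow> c [^] j \<otimes> x \<otimes> c [^] (- j) \<in> K"
    and free: "\<And>k::nat. k > 0 \<Longrightarrow> c [^] k \<notin> K" and dim: "coarse_dim_le G K n"
  shows "coarse_dim_le G (adjoin G c K) (n + 1)"
proof -
  interpret K: subgroup K G by fact
  let ?T = "\<lambda>j::int. c [^] j"
  have T: "?T j \<in> carrier G" for j using c by simp
  have TT: "?T i \<otimes> (?T j \<otimes> x) = ?T (i + j) \<otimes> x" if "x \<in> carrier G" for i j x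
    using that c by (simp add: m_assoc[symmetric] int_pow_mult)
  have free': "j = 0" if "?T j \<in> K" for j
  proof (rule ccontr)
    assume j: "j \<noteq> 0"
    have "?T (- j) \<in> K"
      using K.m_inv_closed[OF that] c by (simp add: int_pow_neg)
    then have "?T \<bar>j\<bar> \<in> K" using that by (simp add: abs_if)
    then have "c [^] nat \<bar>j\<bar> \<in> K" using int_pow_int[of G c "nat \<bar>j\<bar>"] by simp
    then show False using free[of "nat \<bar>j\<bar>"] j by simp
  qed
  have uniq: "i = j" if "?T i \<otimes> x = ?T j \<otimes> y" "x \<in> K" "y \<in> K" for i j x y
  proof -
    have "?T (- j) \<otimes> (?T i \<otimes> x) = ?T (- j) \<otimes> (?T j \<otimes> y)"
      using that(1) by simp
    then have "?T (- j + i) \<otimes> x = ?T (- j + j) \<otimes> y"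
      using that(2,3) by (simp only: TT K.mem_carrier)
    then have "?T (i - j) \<otimes> x = y"
      using that(3) by simp
    then have "?T (i - j) = y \<otimes> inv x"
      using that T by (metis K.mem_carrier inv_solve_right')
    then have "?T (i - j) \<in> K" using that by simp
    then show ?thesis using free' by force
  qed
  define \<pi> where "\<pi> z = (THE j. \<exists>x\<in>K. z = ?T j \<otimes> x)" for z
  have \<pi>: "\<pi> (?T j \<otimes> x) = j" if "x \<in> K" for j x
    unfolding \<pi>_def using that uniq by (intro the_equality) auto
  have ker: "{x \<in> adjoin G c K. \<pi> x = 0} = K"
  proof (intro equalityI subsetI)
    fix x assume "x \<in> {x \<in> adjoin G c K. \<pi> x = 0}"
    then show "x \<in> K" by (auto simp: adjoin_def \<pi>)
  next
    fix x assume "x \<in> K"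
    then show "x \<in> {x \<in> adjoin G c K. \<pi> x = 0}"
      using adjoin_superset[OF K c] \<pi>[of x 0] by auto
  qed
  show ?thesis
  proof (rule coarse_dim_le_int_extension[where \<pi> = \<pi> and t = c])
    show "subgroup (adjoin G c K) G" by (rule subgroup_adjoin[OF K c nrm])
    show "c \<in> adjoin G c K" by (rule adjoin_superset[OF K c])
    show "\<pi> c = 1" using \<pi>[of \<one> 1] c by simp
    show "coarse_dim_le G {x \<in> adjoin G c K. \<pi> x = 0} n" using dim by (simp add: ker)
    fix a b assume "a \<in> adjoin G c K" "b \<in> adjoin G c K"
    then obtain i x j y where ab: "a = ?T i \<otimes> x" "x \<in> K" "b = ?T j \<otimes> y" "y \<in> K"
      by (auto simp: adjoin_def)
    have "?T j \<otimes> (?T (- j) \<otimes> x \<otimes> ?T j) = x \<otimes> ?T j"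
      using ab c by (simp add: m_assoc TT)
    then have "a \<otimes> b = ?T i \<otimes> (?T j \<otimes> (?T (- j) \<otimes> x \<otimes> ?T j)) \<otimes> y"
      using ab T by (simp add: m_assoc)
    also have "\<dots> = ?T (i + j) \<otimes> ((?T (- j) \<otimes> x \<otimes> ?T j) \<otimes> y)"
      using ab T by (simp add: m_assoc TT)
    finally have "\<pi> (a \<otimes> b) = i + j"
      using nrm[of x "- j"] ab by (simp add: \<pi>)
    then show "\<pi> (a \<otimes> b) = \<pi> a + \<pi> b"
      using ab by (simp add: \<pi>)
  qed
qed

text \<open>The conjugate of \<open>x\<close> is a commutator times \<open>x\<close>, and
  commutators lie in \<open>N\<close>.\<close>

lemma conj_in_of_commutators:
  assumes H: "subgroup H G" and K: "subgroup K G" "N \<subseteq> K" "K \<subseteq> H"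
    and comm: "\<And>x y. x \<in> H \<Longrightarrow> y \<in> H \<Longrightarrow> x \<otimes> y \<otimes> inv x \<otimes> inv y \<in> N"
    and c: "c \<in> H" and x: "x \<in> K"
  shows "c [^] (j::int) \<otimes> x \<otimes> c [^] (- j) \<in> K"
proof -
  interpret H: subgroup H G by fact
  interpret K: subgroup K G by fact
  have h: "c [^] j \<in> H" by (rule subgroup_int_pow_closed[OF H c])
  have "c [^] j \<otimes> x \<otimes> inv (c [^] j) \<otimes> inv x \<otimes> x \<in> K"
    using comm[OF h] x K by blast
  moreover have "c [^] j \<otimes> x \<otimes> inv (c [^] j) \<otimes> inv x \<otimes> x = c [^] j \<otimes> x \<otimes> c [^] (- j)"
    using h c x by (simp add: m_assoc int_pow_neg)
  ultimately show ?thesis by simp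
qed

lemma adjoin_list_subgroup:
  assumes H: "subgroup H G" and N: "subgroup N G" "N \<subseteq> H"
    and comm: "\<And>x y. x \<in> H \<Longrightarrow> y \<in> H \<Longrightarrow> x \<otimes> y \<otimes> inv x \<otimes> inv y \<in> N"
    and cs: "set cs \<subseteq> H"
  shows "subgroup (adjoin_list G N cs) G \<and> N \<subseteq> adjoin_list G N cs \<and>
    set cs \<subseteq> adjoin_list G N cs \<and> adjoin_list G N cs \<subseteq> H"
  using cs
proof (induction cs)
  case Nil
  then show ?case using N by simp
next
  case (Cons c cs)
  let ?K = "adjoin_list G N cs"
  from Cons have K: "subgroup ?K G" "N \<subseteq> ?K" "set cs \<subseteq> ?K" "?K \<subseteq> H" and c: "c \<in> H" by auto
  have cG: "c \<in> carrier G" using c subgroup.subset[OF H] by auto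
  have "subgroup (adjoin G c ?K) G"
    by (rule subgroup_adjoin[OF K(1) cG conj_in_of_commutators[OF H K(1,2,4) comm c]])
  then show ?case
    using adjoin_superset[OF K(1) cG] adjoin_subset[OF H K(4) c] K(2,3) by auto
qed

text \<open>The list \<open>ds\<close> keeps those entries of \<open>cs\<close> that had infinite
  order when adjoined. This was tested against the subgroup built from \<open>cs\<close>, which
  contains the one built from \<open>ds\<close>, so \<open>ds\<close> is independent.\<close>

lemma coarse_dim_le_adjoin_list:
  assumes H: "subgroup H G" and N: "subgroup N G" "N \<subseteq> H"
    and comm: "\<And>x y. x \<in> H \<Longrightarrow> y \<in> H \<Longrightarrow> x \<otimes> y \<otimes> inv x \<otimes> inv y \<in> N"
    and dim: "coarse_dim_le G N m" and cs: "set cs \<subseteq> H"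
  shows "\<exists>ds. set ds \<subseteq> H \<and> indep_over G N ds \<and> adjoin_list G N ds \<subseteq> adjoin_list G N cs \<and>
    coarse_dim_le G (adjoin_list G N cs) (m + length ds)"
  using cs
proof (induction cs)
  case Nil
  then show ?case using dim by (intro exI[of _ "[]"]) simp
next
  case (Cons c cs)
  let ?K = "adjoin_list G N cs"
  from Cons obtain ds where ds: "set ds \<subseteq> H" "indep_over G N ds" "adjoin_list G N ds \<subseteq> ?K"
    "coarse_dim_le G ?K (m + length ds)" by auto
  from Cons.prems have c: "c \<in> H" by simp
  have cG: "c \<in> carrier G" using c subgroup.subset[OF H] by auto
  have K: "subgroup ?K G" "N \<subseteq> ?K" "?K \<subseteq> H"
    using adjoin_list_subgroup[OF H N comm, of cs] Cons.prems by auto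
  note nrm = conj_in_of_commutators[OF H K comm c]
  show ?case
  proof (cases "\<exists>k::nat. k > 0 \<and> c [^] k \<in> ?K")
    case True
    then obtain k :: nat where "k > 0" "c [^] k \<in> ?K" by blast
    from coarse_dim_le_adjoin_torsion[OF K(1) cG nrm this ds(4)] show ?thesis
      using ds adjoin_superset(1)[OF K(1) cG] by (intro exI[of _ ds]) auto
  next
    case False
    then have free: "c [^] k \<notin> ?K" if "k > 0" for k :: nat
      using that by blast
    have "coarse_dim_le G (adjoin G c ?K) (m + length ds + 1)"
      by (rule coarse_dim_le_adjoin_free[OF K(1) cG nrm free ds(4)])
    moreover have "indep_over G N (c # ds)"
      using ds(2,3) free by auto
    ultimately show ?thesis
      using ds(1) c adjoin_mono[OF ds(3), of G c] by (intro exI[of _ "c # ds"]) auto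
  qed
qed

text \<open>It suffices to treat subgroups obtained from \<open>N\<close> by adjoining finitely many
  elements: they contain any given finite set, and each costs only the length of an independent
  list.\<close>

lemma coarse_dim_le_abelian_extension:
  assumes H: "subgroup H G" and N: "subgroup N G" "N \<subseteq> H"
    and comm: "\<And>x y. x \<in> H \<Longrightarrow> y \<in> H \<Longrightarrow> x \<otimes> y \<otimes> inv x \<otimes> inv y \<in> N"
    and dim: "coarse_dim_le G N m"
    and rank: "\<And>ds. set ds \<subseteq> H \<Longrightarrow> indep_over G N ds \<Longrightarrow> length ds \<le> r"
  shows "coarse_dim_le G H (m + r)"
proof (rule coarse_dim_le_local[OF H])
  fix F assume F: "finite F" "F \<subseteq> H"
  then obtain cs where cs: "set cs = F" using finite_list by blast
  then obtain ds where ds: "set ds \<subseteq> H" "indep_over G N ds"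
    "coarse_dim_le G (adjoin_list G N cs) (m + length ds)"
    using coarse_dim_le_adjoin_list[OF H N comm dim, of cs] F by auto
  then have "coarse_dim_le G (adjoin_list G N cs) (m + r)"
    using rank by (auto intro: coarse_dim_le_mono)
  then show "\<exists>K. subgroup K G \<and> F \<subseteq> K \<and> K \<subseteq> H \<and> coarse_dim_le G K (m + r)"
    using adjoin_list_subgroup[OF H N comm, of cs] cs F by blast
qed

end

section \<open>Independent elements and the rational rank\<close>

lemma rat_tensor_simps:
  "carrier (rat_tensor A) = carrier (tensor_gens A Mod tensor_rels A)"
  "add (rat_tensor A) = (<#>\<^bsub>tensor_gens A\<^esub>)"
  "\<zero>\<^bsub>rat_tensor A\<^esub> = tensor_rels A"
  "s \<odot>\<^bsub>rat_tensor A\<^esub> X = (\<Union>x\<in>X. tensor_rels A #>\<^bsub>tensor_gens A\<^esub> frag_extend (\<lambda>(a, q). frag_of (a, s * q)) x)"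
  by (simp_all add: rat_tensor_def FactGroup_def)

lemma (in comm_group) commutator_eq_one:
  assumes "x \<in> carrier G" "y \<in> carrier G"
  shows "x \<otimes> y \<otimes> inv x \<otimes> inv y = \<one>"
proof -
  have "x \<otimes> y \<otimes> inv x \<otimes> inv y = (x \<otimes> y) \<otimes> inv (y \<otimes> x)"
    using assms by (simp add: m_assoc inv_mult_group)
  then show ?thesis using assms by (simp add: m_comm[of y x])
qed

text \<open>A copy of \<open>comm_group\<close> without further record fields, as \<open>rat_tensor\<close> requires it.\<close>

locale plain_comm_group = comm_group G for G :: "'a monoid" (structure)
begin

lemma tensor_rels_subgroup: "subgroup (tensor_rels G) (tensor_gens G)"
  unfolding tensor_rels_def
proof (rule group.generate_is_subgroup[OF group_free_Abelian_group])
  let ?F = "tensor_gens G"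
  have minus: "x - y \<in> carrier ?F" if "x \<in> carrier ?F" "y \<in> carrier ?F" for x y
    using that keys_diff[of x y] by auto
  show "{frag_of (a \<otimes> b, q) - frag_of (a, q) - frag_of (b, q) |a b q. a \<in> carrier G \<and> b \<in> carrier G} \<union>
      {frag_of (a, p + q) - frag_of (a, p) - frag_of (a, q) |a p q. a \<in> carrier G} \<subseteq> carrier ?F"
    by (auto simp del: carrier_free_Abelian_group_iff intro!: minus)
qed

text \<open>The floor is harmless: \<open>D\<close> will range over multiples of all occurring denominators.\<close>

definition scaled_eval :: "int \<Rightarrow> ('a \<times> rat \<Rightarrow>\<^sub>0 int) \<Rightarrow> 'a"
  where "scaled_eval D = (SOME h. h \<in> hom (tensor_gens G) G \<and>
    (\<forall>a\<in>carrier G. \<forall>q. h (frag_of (a, q)) = a [^] \<lfloor>rat_of_int D * q\<rfloor>))"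

lemma scaled_eval:
  shows scaled_eval_hom: "scaled_eval D \<in> hom (tensor_gens G) G"
    and scaled_eval_of: "a \<in> carrier G \<Longrightarrow> scaled_eval D (frag_of (a, q)) = a [^] \<lfloor>rat_of_int D * q\<rfloor>"
proof -
  have "(\<lambda>(a, q). a [^] \<lfloor>rat_of_int D * q\<rfloor>) ` (carrier G \<times> UNIV) \<subseteq> carrier G"
    by auto
  then obtain h where h: "h \<in> hom (tensor_gens G) G"
    "\<And>x. x \<in> carrier G \<times> UNIV \<Longrightarrow> h (frag_of x) = (\<lambda>(a, q). a [^] \<lfloor>rat_of_int D * q\<rfloor>) x"
    by (rule free_Abelian_group_universal) blast
  let ?P = "\<lambda>h. h \<in> hom (tensor_gens G) G \<and>
    (\<forall>a\<in>carrier G. \<forall>q. h (frag_of (a, q)) = a [^] \<lfloor>rat_of_int D * q\<rfloor>)"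
  have "?P h"
    using h by auto
  then have "?P (scaled_eval D)"
    unfolding scaled_eval_def by (rule someI[of ?P])
  then show "scaled_eval D \<in> hom (tensor_gens G) G"
    "a \<in> carrier G \<Longrightarrow> scaled_eval D (frag_of (a, q)) = a [^] \<lfloor>rat_of_int D * q\<rfloor>" by auto
qed

lemma scaled_eval_add:
  assumes "x \<in> carrier (tensor_gens G)" "y \<in> carrier (tensor_gens G)"
  shows "scaled_eval D (x + y) = scaled_eval D x \<otimes> scaled_eval D y"
  using hom_mult[OF scaled_eval_hom assms] by simp

lemma scaled_eval_closed: "x \<in> carrier (tensor_gens G) \<Longrightarrow> scaled_eval D x \<in> carrier G"
  using hom_in_carrier[OF scaled_eval_hom] .

lemma scaled_eval_zero: "scaled_eval D 0 = \<one>"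
  using hom_one[OF scaled_eval_hom group_free_Abelian_group] by simp

lemma scaled_eval_uminus:
  assumes "x \<in> carrier (tensor_gens G)"
  shows "scaled_eval D (- x) = inv (scaled_eval D x)"
proof -
  interpret h: group_hom "tensor_gens G" G "scaled_eval D"
    by (intro group_hom.intro group_hom_axioms.intro scaled_eval_hom group_free_Abelian_group is_group)
  show ?thesis using h.hom_inv[OF assms] assms by simp
qed

lemma scaled_eval_diff:
  assumes "x \<in> carrier (tensor_gens G)" "y \<in> carrier (tensor_gens G)"
  shows "scaled_eval D (x - y) = scaled_eval D x \<otimes> inv (scaled_eval D y)"
proof -
  have "- y \<in> carrier (tensor_gens G)" using assms by simp
  then show ?thesis
    using scaled_eval_add[OF assms(1), of "- y" D] scaled_eval_uminus[OF assms(2)] by simp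
qed

text \<open>This models membership of the class of \<open>x\<close> in the image of the tensor
  product of \<open>C\<close> with the rationals. Asking for all multiples of \<open>D\<close>
  allows two witnesses to be multiplied together and \<open>D\<close> to be made divisible by any
  given denominators.\<close>

definition eventually_in :: "'a set \<Rightarrow> ('a \<times> rat \<Rightarrow>\<^sub>0 int) \<Rightarrow> bool"
  where "eventually_in C x \<longleftrightarrow> (\<exists>D>0. \<forall>k>0. scaled_eval (D * k) x \<in> C)"

lemma eventually_in_add:
  assumes C: "subgroup C G" and xy: "x \<in> carrier (tensor_gens G)" "y \<in> carrier (tensor_gens G)"
    and ev: "eventually_in C x" "eventually_in C y"
  shows "eventually_in C (x + y)"
proof -
  obtain D E where D: "D > 0" "\<And>k. k > 0 \<Longrightarrow> scaled_eval (D * k) x \<in> C"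
    and E: "E > 0" "\<And>k. k > 0 \<Longrightarrow> scaled_eval (E * k) y \<in> C"
    using ev unfolding eventually_in_def by blast
  have "scaled_eval (D * E * k) (x + y) \<in> C" if "k > 0" for k
    using D(2)[of "E * k"] E(2)[of "D * k"] that D(1) E(1) subgroup.m_closed[OF C]
    by (simp add: scaled_eval_add[OF xy] mult.assoc mult.left_commute)
  then show ?thesis
    unfolding eventually_in_def using D(1) E(1) by (intro exI[of _ "D * E"]) simp
qed

lemma eventually_in_uminus:
  assumes C: "subgroup C G" and x: "x \<in> carrier (tensor_gens G)" and ev: "eventually_in C x"
  shows "eventually_in C (- x)"
  using ev subgroup.m_inv_closed[OF C] unfolding eventually_in_def scaled_eval_uminus[OF x] by blast

lemma rat_clear_denominator:
  obtains M :: int where "M > 0" "\<And>k. \<exists>j. rat_of_int (M * k) * q = rat_of_int j"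
proof -
  obtain n M where q: "quotient_of q = (n, M)" by (cases "quotient_of q")
  have M: "M > 0" using quotient_of_denom_pos[OF q] .
  have "q = rat_of_int n / rat_of_int M" by (rule quotient_of_div[OF q])
  then have "rat_of_int (M * k) * q = rat_of_int (n * k)" for k
    using M by simp
  then show thesis using M that by blast
qed

text \<open>Additivity in the group variable holds at every scale by commutativity. Additivity in
  the rational variable holds once the scale clears both denominators, since the floors are then
  exact.\<close>

lemma tensor_rels_eventually_one:
  assumes "x \<in> tensor_rels G"
  shows "eventually_in {\<one>} x"
proof -
  let ?F = "tensor_gens G"
  have sub: "subgroup {\<one>} G" by (rule triv_subgroup)
  have relF: "tensor_rels G \<subseteq> carrier ?F"
    by (rule subgroup.subset[OF tensor_rels_subgroup])
  have minus: "y - z \<in> carrier ?F" if "y \<in> carrier ?F" "z \<in> carrier ?F" for y z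
    using that keys_diff[of y z] by auto
  have gens: "eventually_in {\<one>} h"
    if "h \<in> {frag_of (a \<otimes> b, q) - frag_of (a, q) - frag_of (b, q) |a b q. a \<in> carrier G \<and> b \<in> carrier G} \<union>
      {frag_of (a, p + q) - frag_of (a, p) - frag_of (a, q) |a p q. a \<in> carrier G}" for h
    using that
  proof
    assume "h \<in> {frag_of (a \<otimes> b, q) - frag_of (a, q) - frag_of (b, q) |a b q. a \<in> carrier G \<and> b \<in> carrier G}"
    then obtain a b q where ab: "a \<in> carrier G" "b \<in> carrier G"
      and h: "h = frag_of (a \<otimes> b, q) - frag_of (a, q) - frag_of (b, q)" by blast
    have "scaled_eval D h = \<one>" for D
    proof -
      let ?j = "\<lfloor>rat_of_int D * q\<rfloor>"
      have "scaled_eval D h = (a \<otimes> b) [^] ?j \<otimes> inv (a [^] ?j) \<otimes> inv (b [^] ?j)"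
        unfolding h using ab
        by (simp add: scaled_eval_diff minus scaled_eval_of del: carrier_free_Abelian_group_iff)
      also have "\<dots> = \<one>"
        using ab by (simp add: int_pow_distrib commutator_eq_one)
      finally show ?thesis .
    qed
    then show ?thesis unfolding eventually_in_def by (intro exI[of _ 1]) simp
  next
    assume "h \<in> {frag_of (a, p + q) - frag_of (a, p) - frag_of (a, q) |a p q. a \<in> carrier G}"
    then obtain a p q where a: "a \<in> carrier G"
      and h: "h = frag_of (a, p + q) - frag_of (a, p) - frag_of (a, q)" by blast
    obtain M where M: "M > 0" "\<And>k. \<exists>j. rat_of_int (M * k) * p = rat_of_int j"
      using rat_clear_denominator[of p] by blast
    obtain N where N: "N > 0" "\<And>k. \<exists>j. rat_of_int (N * k) * q = rat_of_int j"
      using rat_clear_denominator[of q] by blast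
    have "scaled_eval (M * N * k) h = \<one>" for k
    proof -
      obtain i where i: "rat_of_int (M * N * k) * p = rat_of_int i"
        using M(2)[of "N * k"] by (auto simp: mult.assoc)
      obtain j where j: "rat_of_int (M * N * k) * q = rat_of_int j"
        using N(2)[of "M * k"] by (auto simp: mult_ac)
      have ij: "rat_of_int (M * N * k) * (p + q) = rat_of_int (i + j)"
        unfolding distrib_left i j by simp
      have "scaled_eval (M * N * k) h = a [^] (i + j) \<otimes> inv (a [^] i) \<otimes> inv (a [^] j)"
        unfolding h using a
        by (simp only: scaled_eval_diff minus scaled_eval_of frag_of_in_free_Abelian_group
            mem_Times_iff fst_conv UNIV_I simp_thms i j ij floor_of_int)
      also have "\<dots> = \<one>"
        using a by (simp add: int_pow_mult commutator_eq_one)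
      finally show ?thesis .
    qed
    then show ?thesis unfolding eventually_in_def using M(1) N(1) by (intro exI[of _ "M * N"]) simp
  qed
  show ?thesis
    using assms unfolding tensor_rels_def
  proof (induction x rule: generate.induct)
    case one
    then show ?case by (auto simp: eventually_in_def scaled_eval_zero intro: exI[of _ 1])
  next
    case (incl h)
    then show ?case by (rule gens)
  next
    case (inv h)
    have "h \<in> carrier ?F"
      by (rule subsetD[OF relF[unfolded tensor_rels_def] generate.incl[OF inv]])
    then show ?case using eventually_in_uminus[OF sub _ gens[OF inv]] by simp
  next
    case (eng h1 h2)
    have "h1 \<in> carrier ?F" "h2 \<in> carrier ?F"
      by (rule subsetD[OF relF[unfolded tensor_rels_def]], rule eng)+
    then show ?case using eventually_in_add[OF sub _ _ eng(3,4)] by simp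
  qed
qed

text \<open>At a scale that clears the denominators of \<open>x\<close>, scaling the sum by
  \<open>n / r\<close> and the evaluation by \<open>r\<close> multiplies every exponent by
  \<open>n\<close>. The induction over formal sums collects such a scale as
  \<open>M\<close>.\<close>

lemma scaled_eval_scale:
  fixes s :: rat
  assumes x: "x \<in> carrier (tensor_gens G)" and s: "s = rat_of_int n / rat_of_int r" "r > 0"
  shows "frag_extend (\<lambda>(a, q). frag_of (a, s * q)) x \<in> carrier (tensor_gens G) \<and>
    (\<exists>M>0. \<forall>k>0. scaled_eval (r * (M * k)) (frag_extend (\<lambda>(a, q). frag_of (a, s * q)) x) =
                  scaled_eval (M * k) x [^] n)"
proof -
  let ?F = "tensor_gens G"
  let ?sc = "frag_extend (\<lambda>(a, q). frag_of (a, s * q))"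
  have minus: "y - z \<in> carrier ?F" if "y \<in> carrier ?F" "z \<in> carrier ?F" for y z
    using that keys_diff[of y z] by auto
  from x have "Poly_Mapping.keys x \<subseteq> carrier G \<times> UNIV" by simp
  then have "x \<in> carrier ?F \<and> ?sc x \<in> carrier ?F \<and>
    (\<exists>M>0. \<forall>k>0. scaled_eval (r * (M * k)) (?sc x) = scaled_eval (M * k) x [^] n)"
  proof (induction x rule: frag_induction)
    case zero
    then show ?case by (auto simp: scaled_eval_zero intro: exI[of _ 1])
  next
    case (one x)
    then obtain a q where x: "x = (a, q)" and a: "a \<in> carrier G" by auto
    obtain M where M: "M > 0" "\<And>k. \<exists>j. rat_of_int (M * k) * q = rat_of_int j"
      using rat_clear_denominator[of q] by blast
    have "scaled_eval (r * (M * k)) (?sc (frag_of x)) = scaled_eval (M * k) (frag_of x) [^] n" for k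
    proof -
      obtain j where j: "rat_of_int (M * k) * q = rat_of_int j" using M by blast
      have "rat_of_int (r * (M * k)) * (s * q) = rat_of_int n * (rat_of_int (M * k) * q)"
        using s by simp
      also have "\<dots> = rat_of_int (n * j)" unfolding j by simp
      finally have nj: "rat_of_int (r * (M * k)) * (s * q) = rat_of_int (n * j)" .
      have sc: "?sc (frag_of x) = frag_of (a, s * q)" by (simp add: x)
      show ?thesis
        unfolding sc unfolding x scaled_eval_of[OF a] nj j floor_of_int
        using a by (simp add: int_pow_pow mult.commute)
    qed
    then show ?case using M(1) a by (auto simp: x)
  next
    case (diff y z)
    then obtain M N where M: "M > 0" "\<And>k. k > 0 \<Longrightarrow> scaled_eval (r * (M * k)) (?sc y) = scaled_eval (M * k) y [^] n"
      and N: "N > 0" "\<And>k. k > 0 \<Longrightarrow> scaled_eval (r * (N * k)) (?sc z) = scaled_eval (N * k) z [^] n"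
      by blast
    have yz: "y \<in> carrier ?F" "z \<in> carrier ?F" "?sc y \<in> carrier ?F" "?sc z \<in> carrier ?F"
      using diff by auto
    have "scaled_eval (r * (M * N * k)) (?sc (y - z)) = scaled_eval (M * N * k) (y - z) [^] n" if "k > 0" for k
    proof -
      have 1: "scaled_eval (r * (M * N * k)) (?sc y) = scaled_eval (M * N * k) y [^] n"
        using M(2)[of "N * k"] N(1) that by (simp add: mult.assoc)
      have 2: "scaled_eval (r * (M * N * k)) (?sc z) = scaled_eval (M * N * k) z [^] n"
        using N(2)[of "M * k"] M(1) that by (simp add: mult_ac)
      show ?thesis
        unfolding frag_extend_diff scaled_eval_diff[OF yz(3,4)] scaled_eval_diff[OF yz(1,2)] 1 2
        using scaled_eval_closed[OF yz(1)] scaled_eval_closed[OF yz(2)]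
        by (simp add: int_pow_distrib int_pow_inv)
    qed
    then have "\<exists>M>0. \<forall>k>0. scaled_eval (r * (M * k)) (?sc (y - z)) = scaled_eval (M * k) (y - z) [^] n"
      using M(1) N(1) by (intro exI[of _ "M * N"]) simp
    then show ?case
      using minus[OF yz(1,2)] minus[OF yz(3,4)] by (simp only: frag_extend_diff simp_thms)
  qed
  then show ?thesis by blast
qed

text \<open>The numerator of \<open>s\<close> becomes a power, which stays in \<open>C\<close>, and
  the denominator is absorbed into the scale.\<close>

lemma eventually_in_scale:
  fixes s :: rat
  assumes C: "subgroup C G" and x: "x \<in> carrier (tensor_gens G)" and ev: "eventually_in C x"
  shows "eventually_in C (frag_extend (\<lambda>(a, q). frag_of (a, s * q)) x)"
proof -
  obtain n r where q: "quotient_of s = (n, r)" by (cases "quotient_of s")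
  have r: "r > 0" using quotient_of_denom_pos[OF q] .
  let ?sc = "frag_extend (\<lambda>(a, q). frag_of (a, s * q))"
  obtain M where M: "M > 0" "\<And>k. k > 0 \<Longrightarrow> scaled_eval (r * (M * k)) (?sc x) = scaled_eval (M * k) x [^] n"
    using scaled_eval_scale[OF x quotient_of_div[OF q] r] by blast
  obtain D where D: "D > 0" "\<And>k. k > 0 \<Longrightarrow> scaled_eval (D * k) x \<in> C"
    using ev unfolding eventually_in_def by blast
  have "scaled_eval (r * M * D * k) (?sc x) \<in> C" if "k > 0" for k
  proof -
    have "scaled_eval (r * M * D * k) (?sc x) = scaled_eval (D * (M * k)) x [^] n"
      using M(2)[of "D * k"] D(1) that by (simp add: mult_ac)
    also have "\<dots> \<in> C"
      using D(2)[of "M * k"] M(1) that by (intro subgroup_int_pow_closed[OF C]) simp_all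
    finally show ?thesis .
  qed
  then show ?thesis
    unfolding eventually_in_def using r M(1) D(1) by (intro exI[of _ "r * M * D"]) simp
qed

section \<open>Linear independence in the tensor product\<close>

definition tensor_class :: "'a \<Rightarrow> ('a \<times> rat \<Rightarrow>\<^sub>0 int) set"
  where "tensor_class a = tensor_rels G #>\<^bsub>tensor_gens G\<^esub> frag_of (a, 1)"

lemma vectorspace_tensor: "vectorspace rat_field (rat_tensor G)"
  by (rule vectorspace_rat_tensor) (rule comm_group_axioms)

lemma tensor_class_closed: "a \<in> carrier G \<Longrightarrow> tensor_class a \<in> carrier (rat_tensor G)"
  by (auto simp: rat_tensor_simps FactGroup_def RCOSETS_def tensor_class_def)

text \<open>The classes whose representatives are all eventually in \<open>C\<close> form a subspace
  containing the classes from \<open>Y\<close>. If it contained the class of \<open>b\<close>, some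
  positive power of \<open>b\<close> would lie in \<open>C\<close>.\<close>

lemma tensor_class_notin_span:
  assumes C: "subgroup C G" and Y: "Y \<subseteq> C" and b: "b \<in> carrier G"
    and free: "\<And>k::nat. k > 0 \<Longrightarrow> b [^] k \<notin> C"
  shows "tensor_class b \<notin> LinearCombinations.module.span rat_field (rat_tensor G) (tensor_class ` Y)"
proof
  let ?F = "tensor_gens G" and ?W = "tensor_rels G" and ?V = "rat_tensor G"
  interpret V: vectorspace rat_field ?V by (rule vectorspace_tensor)
  interpret F: group ?F by simp
  assume mem: "tensor_class b \<in> LinearCombinations.module.span rat_field ?V (tensor_class ` Y)"
  define T where "T = {X \<in> carrier ?V. \<forall>x\<in>X. eventually_in C x}"
  have W: "?W \<subseteq> carrier ?F" by (rule subgroup.subset[OF tensor_rels_subgroup])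
  have V_sub: "X \<subseteq> carrier ?F" if "X \<in> carrier ?V" for X
    using that F.r_coset_subset_G[OF W] by (auto simp: rat_tensor_simps FactGroup_def RCOSETS_def simp del: carrier_free_Abelian_group_iff)
  have W_ev: "eventually_in C x" if "x \<in> ?W" for x
    using tensor_rels_eventually_one[OF that] subgroup.one_closed[OF C]
    unfolding eventually_in_def by auto
  \<comment> \<open>Relations are eventually trivial, so one representative decides for its whole
    coset.\<close>
  have coset_ev: "eventually_in C y"
    if "y \<in> ?W #>\<^bsub>?F\<^esub> x" "x \<in> carrier ?F" "eventually_in C x" for x y
  proof -
    from that(1) obtain w where w: "w \<in> ?W" "y = w + x" by (auto simp: r_coset_def)
    have "w \<in> carrier ?F" using w W by blast
    then show ?thesis
      unfolding w(2) using that(2,3) W_ev[OF w(1)] by (intro eventually_in_add[OF C])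
  qed
  have class_ev: "eventually_in C (frag_of (y, 1))" if "y \<in> C" for y
  proof -
    have yG: "y \<in> carrier G" using that subgroup.subset[OF C] by auto
    have "scaled_eval k (frag_of (y, 1)) \<in> C" for k
      using subgroup_int_pow_closed[OF C that, of k] by (simp add: scaled_eval_of[OF yG])
    then show ?thesis unfolding eventually_in_def by (intro exI[of _ 1]) simp
  qed
  have "submodule rat_field T ?V"
  proof (rule submodule.intro)
    show "module rat_field ?V" by (rule V.module_axioms)
    show "T \<subseteq> carrier ?V" by (auto simp: T_def)
    show "\<zero>\<^bsub>?V\<^esub> \<in> T"
      using V.zero_closed W_ev by (auto simp: T_def rat_tensor_simps(3))
  next
    fix X Y assume XY: "X \<in> T" "Y \<in> T"
    have "eventually_in C z" if "z \<in> X \<oplus>\<^bsub>?V\<^esub> Y" for z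
    proof -
      from that obtain x y where z: "z = x + y" "x \<in> X" "y \<in> Y"
        by (auto simp: rat_tensor_simps(2) set_mult_def)
      have "x \<in> carrier ?F" "y \<in> carrier ?F"
        using z XY V_sub by (auto simp: T_def simp del: carrier_free_Abelian_group_iff)
      then show ?thesis
        unfolding z(1) using z XY by (intro eventually_in_add[OF C]) (auto simp: T_def)
    qed
    then show "X \<oplus>\<^bsub>?V\<^esub> Y \<in> T" using XY V.add.m_closed by (auto simp: T_def)
  next
    fix s X assume sX: "s \<in> carrier rat_field" "X \<in> T"
    let ?sc = "frag_extend (\<lambda>(a, q). frag_of (a, s * q))"
    obtain n r where q: "quotient_of s = (n, r)" by (cases "quotient_of s")
    have "eventually_in C z" if "z \<in> s \<odot>\<^bsub>?V\<^esub> X" for z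
    proof -
      from that obtain x where x: "x \<in> X" "z \<in> ?W #>\<^bsub>?F\<^esub> ?sc x"
        by (auto simp: rat_tensor_simps(4))
      have xF: "x \<in> carrier ?F" using x(1) sX(2) V_sub[of X] unfolding T_def by blast
      have "eventually_in C x" using x(1) sX(2) by (auto simp: T_def)
      then show ?thesis
        using coset_ev[OF x(2)] scaled_eval_scale[OF xF quotient_of_div[OF q] quotient_of_denom_pos[OF q]]
          eventually_in_scale[OF C xF] by blast
    qed
    then show "s \<odot>\<^bsub>?V\<^esub> X \<in> T"
      using sX V.smult_closed by (auto simp: T_def)
  qed
  moreover have "tensor_class ` Y \<subseteq> T"
  proof
    fix X assume "X \<in> tensor_class ` Y"
    then obtain y where y: "y \<in> C" "X = tensor_class y" using Y by blast
    have yG: "y \<in> carrier G" using y subgroup.subset[OF C] by auto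
    have "eventually_in C x" if "x \<in> X" for x
      using that coset_ev[OF _ _ class_ev[OF y(1)]] yG by (auto simp: y(2) tensor_class_def)
    then show "X \<in> T" using tensor_class_closed[OF yG] y by (auto simp: T_def)
  qed
  ultimately have "LinearCombinations.module.span rat_field ?V (tensor_class ` Y) \<subseteq> T"
    by (intro V.span_is_subset)
  then have "tensor_class b \<in> T" using mem by blast
  moreover have "frag_of (b, 1) \<in> tensor_class b"
    unfolding tensor_class_def using b by (intro F.rcos_self tensor_rels_subgroup) simp
  ultimately have "eventually_in C (frag_of (b, 1))" by (auto simp: T_def)
  then obtain D where D: "D > 0" "\<forall>k>0. scaled_eval (D * k) (frag_of (b, 1)) \<in> C"
    unfolding eventually_in_def by blast
  from D(2)[rule_format, of 1] have "b [^] D \<in> C" by (simp add: scaled_eval_of[OF b])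
  then have "b [^] nat D \<in> C" using D(1) int_pow_int[of G b "nat D"] by simp
  then show False using free[of "nat D"] D(1) by simp
qed

text \<open>Each class lies outside the span of the classes behind it in the list. This gives
  independence and also distinctness, which turns the length of the list into a cardinality.\<close>

lemma length_indep_le_rat_rank:
  assumes "set bs \<subseteq> carrier G" "indep_over G {\<one>} bs"
  shows "enat (length bs) \<le> rat_rank G"
proof -
  interpret V: vectorspace rat_field "rat_tensor G" by (rule vectorspace_tensor)
  have "V.lin_indpt (tensor_class ` set bs) \<and> card (tensor_class ` set bs) = length bs"
    using assms
  proof (induction bs)
    case Nil
    have "V.lin_indpt {}" by (simp add: V.lin_dep_def)
    then show ?case by simp
  next
    case (Cons b bs)
    let ?C = "adjoin_list G {\<one>} bs" and ?S = "tensor_class ` set bs"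
    have C: "subgroup ?C G" "set bs \<subseteq> ?C"
      using adjoin_list_subgroup[OF subgroup_self triv_subgroup, of bs] Cons.prems by (auto simp: commutator_eq_one)
    have b: "b \<in> carrier G" using Cons.prems by simp
    have S: "?S \<subseteq> carrier (rat_tensor G)"
      using Cons.prems tensor_class_closed by auto
    have notin: "tensor_class b \<notin> V.span ?S"
      using Cons.prems by (intro tensor_class_notin_span[OF C b]) auto
    then have "tensor_class b \<notin> ?S"
      using V.in_own_span[OF S] by blast
    moreover have "V.lin_indpt (?S \<union> {tensor_class b})"
      using V.lin_dep_iff_in_span[OF S _ tensor_class_closed[OF b] calculation] Cons notin by auto
    ultimately show ?case using Cons by simp
  qed
  then show ?thesis
    using V.li_le_dim(2)[of "tensor_class ` set bs"] assms(1) tensor_class_closed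
    by (auto simp: rat_rank_def)
qed

end

section \<open>Elementary amenable groups\<close>

context group
begin

text \<open>The map \<open>\<phi>\<close> separates right cosets, for instance as a coset map pulled
  back from a quotient. Inverses turn representatives of right cosets into those of left cosets,
  which the decomposition \<open>t \<otimes> k\<close> needs.\<close>

lemma coarse_dim_le_of_finite_index:
  assumes K: "subgroup K G" and fin: "finite (\<phi> ` carrier G)"
    and \<phi>: "\<And>x y. x \<in> carrier G \<Longrightarrow> y \<in> carrier G \<Longrightarrow> \<phi> x = \<phi> y \<Longrightarrow> x \<otimes> inv y \<in> K"
    and dim: "coarse_dim_le G K n"
  shows "coarse_dim_le G (carrier G) n"
proof -
  interpret K: subgroup K G by (rule K)
  obtain Y where Y: "Y \<subseteq> carrier G" "finite Y" "\<phi> ` Y = \<phi> ` carrier G"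
    using finite_subset_image[OF fin, of \<phi> "carrier G"] by auto
  show ?thesis
  proof (rule coarse_dim_le_finite_index[OF subgroup_self K K.subset _ _ _ dim, of "m_inv G ` Y"])
    show "finite (m_inv G ` Y)" "m_inv G ` Y \<subseteq> carrier G" using Y by auto
    fix x assume x: "x \<in> carrier G"
    then have "\<phi> (inv x) \<in> \<phi> ` Y" using Y by auto
    then obtain y where y: "y \<in> Y" "\<phi> (inv x) = \<phi> y" by auto
    then have yG: "y \<in> carrier G" using Y by auto
    have "inv (inv x \<otimes> inv y) \<in> K"
      using \<phi>[OF inv_closed[OF x] yG y(2)] by (rule K.m_inv_closed)
    then have k: "y \<otimes> x \<in> K" using x yG by (simp add: inv_mult_group)
    have "x = inv y \<otimes> (y \<otimes> x)" using x yG by (simp add: m_assoc[symmetric])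
    then show "\<exists>t\<in>m_inv G ` Y. \<exists>k\<in>K. x = t \<otimes> k" using y k by blast
  qed
qed

lemma rcos_eq_imp_diff_in:
  assumes "subgroup A G" "x \<in> carrier G" "y \<in> carrier G" "A #> x = A #> y"
  shows "x \<otimes> inv y \<in> A"
proof -
  have "x \<in> A #> y" using rcos_self[OF assms(2,1)] assms(4) by simp
  then obtain a where a: "a \<in> A" "x = a \<otimes> y" by (auto simp: r_coset_def)
  then have "x \<otimes> inv y = a"
    using assms(3) subgroup.mem_carrier[OF assms(1) a(1)] by (simp add: m_assoc)
  then show ?thesis using a by simp
qed

text \<open>A relation among the images in \<open>B\<close> lifts to a relation modulo the kernel,
  so lists independent over the kernel have independent images, and the rank of \<open>B\<close>
  bounds their length. The type of \<open>B\<close> is separate because the elements of a quotient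
  group are cosets.\<close>

lemma coarse_dim_le_rank_extension:
  fixes B :: "'c monoid" and \<phi> :: "'a \<Rightarrow> 'c"
  assumes H: "subgroup H G" and B: "comm_group B"
    and \<phi>: "\<And>x. x \<in> H \<Longrightarrow> \<phi> x \<in> carrier B"
      "\<And>x y. x \<in> H \<Longrightarrow> y \<in> H \<Longrightarrow> \<phi> (x \<otimes> y) = \<phi> x \<otimes>\<^bsub>B\<^esub> \<phi> y"
    and dim: "coarse_dim_le G {x \<in> H. \<phi> x = \<one>\<^bsub>B\<^esub>} m"
    and rank: "rat_rank B \<le> enat r"
  shows "coarse_dim_le G H (m + r)"
proof -
  interpret H: subgroup H G by (rule H)
  interpret B: plain_comm_group B using B by (rule plain_comm_group.intro)
  interpret h: group_hom "G\<lparr>carrier := H\<rparr>" B \<phi>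
    by (intro group_hom.intro group_hom_axioms.intro subgroup_imp_group[OF H] B.is_group)
      (auto simp: hom_def \<phi>)
  define N where "N = {x \<in> H. \<phi> x = \<one>\<^bsub>B\<^esub>}"
  have \<phi>_one: "\<phi> \<one> = \<one>\<^bsub>B\<^esub>" using h.hom_one by simp
  have \<phi>_inv: "\<phi> (inv x) = inv\<^bsub>B\<^esub> \<phi> x" if "x \<in> H" for x
    using h.hom_inv[of x] that by (simp add: m_inv_consistent[OF H])
  have \<phi>_pow: "\<phi> (x [^] (j::int)) = \<phi> x [^]\<^bsub>B\<^esub> j" if "x \<in> H" for x j
    using h.hom_int_pow[of x j] that by (simp add: int_pow_consistent[OF H, symmetric])
  have pow_H: "x [^] (j::int) \<in> H" if "x \<in> H" for x j
    by (rule subgroup_int_pow_closed[OF H that])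
  have N: "subgroup N G" "N \<subseteq> H"
    by (rule subgroupI) (auto simp: N_def \<phi>_one \<phi>_inv \<phi> intro: exI[of _ \<one>])
  have comm: "x \<otimes> y \<otimes> inv x \<otimes> inv y \<in> N" if xy: "x \<in> H" "y \<in> H" for x y
  proof -
    have "\<phi> (x \<otimes> y \<otimes> inv x \<otimes> inv y) = \<one>\<^bsub>B\<^esub>"
      using xy by (simp add: \<phi> \<phi>_inv B.commutator_eq_one)
    then show ?thesis using xy by (simp add: N_def)
  qed
  have lift: "x \<in> adjoin_list G N ds"
    if "set ds \<subseteq> H" "x \<in> H" "\<phi> x \<in> adjoin_list B {\<one>\<^bsub>B\<^esub>} (map \<phi> ds)" for ds x
    using that
  proof (induction ds arbitrary: x)
    case Nil
    then show ?case by (simp add: N_def)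
  next
    case (Cons d ds)
    let ?C = "adjoin_list B {\<one>\<^bsub>B\<^esub>} (map \<phi> ds)"
    have d: "d \<in> H" "set ds \<subseteq> H" using Cons.prems by auto
    obtain j y where y: "y \<in> ?C" "\<phi> x = \<phi> d [^]\<^bsub>B\<^esub> (j::int) \<otimes>\<^bsub>B\<^esub> y"
      using Cons.prems(3) by (auto elim: adjoinE)
    have "set (map \<phi> ds) \<subseteq> carrier B" using d(2) \<phi>(1) by auto
    then have "?C \<subseteq> carrier B"
      using B.adjoin_list_subgroup[OF B.subgroup_self B.triv_subgroup, of "map \<phi> ds"]
      by (simp add: B.commutator_eq_one)
    then have yB: "y \<in> carrier B" using y by auto
    define x' where "x' = d [^] (- j) \<otimes> x"
    have x'H: "x' \<in> H" using pow_H[OF d(1)] Cons.prems(2) by (simp add: x'_def)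
    have "\<phi> x' = \<phi> d [^]\<^bsub>B\<^esub> (- j) \<otimes>\<^bsub>B\<^esub> (\<phi> d [^]\<^bsub>B\<^esub> j \<otimes>\<^bsub>B\<^esub> y)"
      unfolding x'_def using Cons.prems(2) by (simp add: \<phi>(2) pow_H \<phi>_pow d y(2))
    also have "\<dots> = y"
      using yB \<phi>(1)[OF d(1)] by (simp add: B.m_assoc[symmetric] B.int_pow_mult[symmetric])
    finally have "x' \<in> adjoin_list G N ds"
      using Cons.IH[OF d(2) x'H] y(1) by simp
    moreover have "x = d [^] j \<otimes> x'"
      using d(1) Cons.prems(2) by (simp add: x'_def m_assoc[symmetric] int_pow_mult[symmetric])
    ultimately show ?case using adjoinI[of x' _ G d j] by simp
  qed
  have indep: "indep_over B {\<one>\<^bsub>B\<^esub>} (map \<phi> ds)" if "set ds \<subseteq> H" "indep_over G N ds" for ds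
    using that
  proof (induction ds)
    case (Cons d ds)
    have "\<phi> d [^]\<^bsub>B\<^esub> k \<notin> adjoin_list B {\<one>\<^bsub>B\<^esub>} (map \<phi> ds)" if "k > 0" for k :: nat
    proof
      assume *: "\<phi> d [^]\<^bsub>B\<^esub> k \<in> adjoin_list B {\<one>\<^bsub>B\<^esub>} (map \<phi> ds)"
      have d: "d \<in> H" "set ds \<subseteq> H" using Cons.prems by auto
      have "d [^] k \<in> H" using pow_H[OF d(1), of "int k"] by (simp add: int_pow_int)
      moreover have "\<phi> (d [^] k) = \<phi> d [^]\<^bsub>B\<^esub> k"
        using \<phi>_pow[OF d(1), of "int k"] by (simp add: int_pow_int)
      ultimately have "d [^] k \<in> adjoin_list G N ds" using lift[OF d(2)] * by simp
      then show False using Cons.prems(2) that by simp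
    qed
    then show ?case using Cons by simp
  qed simp
  show ?thesis
  proof (rule coarse_dim_le_abelian_extension[OF H N comm])
    show "coarse_dim_le G N m" using dim by (simp add: N_def)
    fix ds assume ds: "set ds \<subseteq> H" "indep_over G N ds"
    have "enat (length (map \<phi> ds)) \<le> rat_rank B"
      using ds \<phi>(1) by (intro B.length_indep_le_rat_rank indep) auto
    then have "enat (length ds) \<le> enat r" using rank by (metis length_map order_trans)
    then show "length ds \<le> r" by simp
  qed
qed

text \<open>The preimage \<open>H\<close> of \<open>B\<close> is an abelian extension of
  \<open>N\<close>, which costs the rank of \<open>B\<close>; it has finite index in
  \<open>G\<close>, which costs nothing.\<close>

lemma coarse_dim_le_virtually_abelian_extension:
  assumes N: "N \<lhd> G" and dim: "coarse_dim_le G N m"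
    and B: "finite_index_abelian B (G Mod N)" "rat_rank ((G Mod N)\<lparr>carrier := B\<rparr>) \<le> enat r"
  shows "coarse_dim_le G (carrier G) (m + r)"
proof -
  interpret N: normal N G by (rule N)
  let ?Q = "G Mod N"
  interpret Q: group ?Q by (rule N.factorgroup_is_group)
  have BQ: "subgroup B ?Q" "finite (rcosets\<^bsub>?Q\<^esub> B)" "comm_group (?Q\<lparr>carrier := B\<rparr>)"
    using B(1) by (auto simp: finite_index_abelian_def)
  interpret B: subgroup B ?Q by (rule BQ)
  interpret q: group_hom G ?Q "\<lambda>x. N #> x"
    using N.r_coset_hom_Mod by (intro group_hom.intro group_hom_axioms.intro is_group Q.is_group)
  define H where "H = {x \<in> carrier G. N #> x \<in> B}"
  have H: "subgroup H G"
  proof (rule subgroupI)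
    show "H \<noteq> {}" using B.one_closed q.hom_one by (auto simp: H_def intro!: exI[of _ \<one>])
  next
    fix x assume "x \<in> H"
    then show "inv x \<in> H" using q.hom_inv[of x] B.m_inv_closed[of "N #> x"] by (auto simp: H_def)
  next
    fix x y assume "x \<in> H" "y \<in> H"
    then show "x \<otimes> y \<in> H" using q.hom_mult[of x y] B.m_closed[of "N #> x" "N #> y"] by (auto simp: H_def)
  qed (auto simp: H_def)
  have ker: "{x \<in> H. N #> x = \<one>\<^bsub>?Q\<lparr>carrier := B\<rparr>\<^esub>} = N"
  proof (intro equalityI subsetI)
    fix x assume "x \<in> {x \<in> H. N #> x = \<one>\<^bsub>?Q\<lparr>carrier := B\<rparr>\<^esub>}"
    then show "x \<in> N"
      using coset_join1[of N x] N.is_subgroup by (auto simp: H_def FactGroup_def)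
  next
    fix x assume x: "x \<in> N"
    then have "N #> x = \<one>\<^bsub>?Q\<^esub>"
      using coset_join2[of x N] N.is_subgroup by (auto simp: FactGroup_def)
    then show "x \<in> {x \<in> H. N #> x = \<one>\<^bsub>?Q\<lparr>carrier := B\<rparr>\<^esub>}"
      using x B.one_closed by (auto simp: H_def)
  qed
  have "coarse_dim_le G H (m + r)"
  proof (rule coarse_dim_le_rank_extension[OF H BQ(3), where \<phi> = "\<lambda>x. N #> x"])
    show "coarse_dim_le G {x \<in> H. N #> x = \<one>\<^bsub>?Q\<lparr>carrier := B\<rparr>\<^esub>} m" using dim by (simp only: ker)
  qed (use B(2) q.hom_mult in \<open>auto simp: H_def\<close>)
  then show ?thesis
  proof (rule coarse_dim_le_of_finite_index[OF H, of "\<lambda>x. B #>\<^bsub>?Q\<^esub> (N #> x)", rotated 2])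
    have "(\<lambda>x. B #>\<^bsub>?Q\<^esub> (N #> x)) ` carrier G \<subseteq> rcosets\<^bsub>?Q\<^esub> B"
      using q.hom_closed unfolding RCOSETS_def by blast
    then show "finite ((\<lambda>x. B #>\<^bsub>?Q\<^esub> (N #> x)) ` carrier G)"
      using BQ(2) by (rule finite_subset)
    fix x y assume xy: "x \<in> carrier G" "y \<in> carrier G" "B #>\<^bsub>?Q\<^esub> (N #> x) = B #>\<^bsub>?Q\<^esub> (N #> y)"
    have "(N #> x) \<otimes>\<^bsub>?Q\<^esub> inv\<^bsub>?Q\<^esub> (N #> y) \<in> B"
      using Q.rcos_eq_imp_diff_in[OF BQ(1) q.hom_closed[OF xy(1)] q.hom_closed[OF xy(2)] xy(3)] .
    then show "x \<otimes> inv y \<in> H"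
      using xy q.hom_mult[of x "inv y"] q.hom_inv[of y] by (auto simp: H_def)
  qed
qed

end

text \<open>The abelian subgroup is treated as an extension of the trivial group by itself, with the
  identity as \<open>\<phi>\<close>.\<close>

lemma coarse_dim_le_virtually_abelian:
  assumes A: "finite_index_abelian A H" "rat_rank (H\<lparr>carrier := A\<rparr>) \<le> enat r"
  shows "coarse_dim_le H (carrier H) r"
proof -
  have H: "group H" "subgroup A H" "finite (rcosets\<^bsub>H\<^esub> A)" "comm_group (H\<lparr>carrier := A\<rparr>)"
    using A(1) by (auto simp: finite_index_abelian_def)
  interpret H: group H by (rule H)
  have "{x \<in> A. x = \<one>\<^bsub>H\<lparr>carrier := A\<rparr>\<^esub>} = {\<one>\<^bsub>H\<^esub>}"
    using subgroup.one_closed[OF H(2)] by auto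
  then have "coarse_dim_le H {x \<in> A. x = \<one>\<^bsub>H\<lparr>carrier := A\<rparr>\<^esub>} 0"
    using H.coarse_dim_le_trivial by simp
  then have "coarse_dim_le H A (0 + r)"
    by (intro H.coarse_dim_le_rank_extension[OF H(2,4), where \<phi> = "\<lambda>x. x"] A(2)) auto
  then have "coarse_dim_le H A r" by simp
  then show ?thesis
  proof (rule H.coarse_dim_le_of_finite_index[OF H(2), of "\<lambda>x. A #>\<^bsub>H\<^esub> x", rotated 2])
    have "(\<lambda>x. A #>\<^bsub>H\<^esub> x) ` carrier H = rcosets\<^bsub>H\<^esub> A"
      by (auto simp: RCOSETS_def)
    then show "finite ((\<lambda>x. A #>\<^bsub>H\<^esub> x) ` carrier H)" using H(3) by simp
  qed (rule H.rcos_eq_imp_diff_in[OF H(2)])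
qed

section \<open>Values of the Hirsch length\<close>

text \<open>Quantifying over all finite \<open>n\<close> above the value suits the supremum clause:
  every subgroup generated by a finite set then has a value at most \<open>n\<close>. An infinite
  value imposes nothing.\<close>

lemma coarse_dim_le_of_hirsch_value:
  assumes "hirsch_value G v"
  shows "group G \<and> (\<forall>n. v \<le> enat n \<longrightarrow> coarse_dim_le G (carrier G) n)"
  using assms
proof (induction rule: hirsch_value.induct)
  case (virtually_abelian A G)
  then have "group G" by (simp add: finite_index_abelian_def)
  then show ?case
    using coarse_dim_le_virtually_abelian[OF virtually_abelian] by blast
next
  case (locally \<X> H h)
  have H: "group H" using locally by (simp add: locally_in_def)
  interpret H: group H by (rule H)
  have "coarse_dim_le H (carrier H) n"
    if n: "(SUP F\<in>{F. subgroup F H \<and> H\<lparr>carrier := F\<rparr> \<in> \<X>}. h F) \<le> enat n" for n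
  proof (rule H.coarse_dim_le_local[OF H.subgroup_self])
    fix F assume F: "finite F" "F \<subseteq> carrier H"
    let ?K = "generate H F"
    have K: "subgroup ?K H" by (rule H.generate_is_subgroup[OF F(2)])
    have KX: "H\<lparr>carrier := ?K\<rparr> \<in> \<X>" using locally(2) F by (auto simp: locally_in_def)
    have "h ?K \<le> enat n"
      using n K KX by (simp add: SUP_le_iff)
    then have "coarse_dim_le H ?K n"
      using locally(3) K KX by auto
    then show "\<exists>K. subgroup K H \<and> F \<subseteq> K \<and> K \<subseteq> carrier H \<and> coarse_dim_le H K n"
      using K generate.incl[of _ F H] subgroup.subset[OF K] by blast
  qed
  then show ?case using H by blast
next
  case (extension G N \<X> m B)
  interpret G: group G by (rule extension)
  have "coarse_dim_le G (carrier G) n"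
    if n: "m + rat_rank ((G Mod N)\<lparr>carrier := B\<rparr>) \<le> enat n" for n
  proof -
    obtain k where k: "m = enat k" using n by (cases m) auto
    obtain r where r: "rat_rank ((G Mod N)\<lparr>carrier := B\<rparr>) = enat r"
      using n by (cases "rat_rank ((G Mod N)\<lparr>carrier := B\<rparr>)") auto
    have "coarse_dim_le G N k" using extension.IH k by simp
    then have "coarse_dim_le G (carrier G) (k + r)"
      using r by (intro G.coarse_dim_le_virtually_abelian_extension[OF extension(2) _ extension(6)]) simp_all
    then show ?thesis
      by (rule coarse_dim_le_mono) (use n k r in simp)
  qed
  then show ?case using extension(1) by blast
qed

lemma hirsch_value_exists:
  assumes "elementary_amenable G"
  shows "\<exists>v. hirsch_value G v"
proof -
  obtain r :: "'a monoid set rel" and \<alpha> where r: "Well_order r" and G: "G \<in> ea_class r \<alpha>"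
    using assms by (auto simp: elementary_amenable_def is_ea_class_def)
  interpret r: wo_rel r using r by (simp add: wo_rel_def)
  have va: "\<exists>v. hirsch_value H v" if "virtually_abelian H" for H :: "'a monoid"
    using that hirsch_value.virtually_abelian unfolding virtually_abelian_def by blast
  have "\<forall>H \<in> (ea_class r \<alpha> :: 'a monoid set). \<exists>v. hirsch_value H v"
  proof (induction \<alpha> rule: r.well_order_inductZSL)
    case Zero
    have "virtually_abelian H" if H: "group H" "carrier H = {\<one>\<^bsub>H\<^esub>}" for H :: "'a monoid"
    proof -
      interpret H: group H by (rule H)
      have "rcosets\<^bsub>H\<^esub> {\<one>\<^bsub>H\<^esub>} \<subseteq> (\<lambda>x. {\<one>\<^bsub>H\<^esub>} #>\<^bsub>H\<^esub> x) ` carrier H"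
        by (auto simp: RCOSETS_def)
      then have "finite (rcosets\<^bsub>H\<^esub> {\<one>\<^bsub>H\<^esub>})"
        by (rule finite_subset) (simp add: H(2))
      moreover have "group (H\<lparr>carrier := {\<one>\<^bsub>H\<^esub>}\<rparr>)"
        by (rule H.subgroup_imp_group[OF H.triv_subgroup])
      then have "comm_group (H\<lparr>carrier := {\<one>\<^bsub>H\<^esub>}\<rparr>)"
        by (rule group.group_comm_groupI) simp
      ultimately show ?thesis
        unfolding virtually_abelian_def finite_index_abelian_def
        using H.triv_subgroup H(1) by blast
    qed
    then show ?case using va unfolding ea_class_zero[OF r] by blast
  next
    case (Suc i)
    have "\<exists>v. hirsch_value H v"
      if H: "group H" "N \<lhd> H" "H\<lparr>carrier := N\<rparr> \<in> locally_in (ea_class r i)" "virtually_abelian (H Mod N)"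
      for H :: "'a monoid" and N
    proof -
      have "i \<in> Field r" using Suc(1) by (auto simp: aboveS_def intro: FieldI1)
      then have X: "is_ea_class (ea_class r i :: 'a monoid set)" using r by (auto simp: is_ea_class_def)
      let ?K = "H\<lparr>carrier := N\<rparr>"
      \<comment> \<open>The clause for local membership takes a function assigning values to all
        subgroups in the class, so the values are chosen simultaneously.\<close>
      obtain h :: "'a monoid \<Rightarrow> enat" where h: "\<And>L. L \<in> ea_class r i \<Longrightarrow> hirsch_value L (h L)"
        using Suc(2) by metis
      have "\<forall>F. subgroup F ?K \<and> ?K\<lparr>carrier := F\<rparr> \<in> ea_class r i \<longrightarrow>
          hirsch_value (?K\<lparr>carrier := F\<rparr>) (h (?K\<lparr>carrier := F\<rparr>))"
        by (intro allI impI h) (rule conjunct2)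
      note hirsch_value.locally[OF X H(3) this]
      moreover obtain B where "finite_index_abelian B (H Mod N)"
        using H(4) by (auto simp: virtually_abelian_def)
      ultimately show ?thesis
        by (intro exI) (rule hirsch_value.extension[OF H(1,2) X H(3)])
    qed
    then show ?case
      using va by (auto simp: ea_class_succ[OF r Suc(1)])
  next
    case (Lim i)
    then show ?case by (auto simp: ea_class_limit[OF r])
  qed
  then show ?thesis using G by blast
qed

section \<open>From coarse dimension to metrics\<close>

text \<open>The cover consists of the \<open>R\<close>-neighbourhoods of the cells. A point
  \<open>y\<close> lies in the neighbourhood of the cell labelled \<open>g\<close> exactly if
  \<open>g\<close> is among the labels on the translate of \<open>F\<close> by \<open>y\<close>, so
  the count of labels bounds the multiplicity.\<close>

lemma asdim_le_of_coarse_dim_le: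
  assumes G: "group G" and metric: "proper_right_invariant_metric G d"
    and dim: "coarse_dim_le G (carrier G) n"
  shows "asdim_le (carrier G) d n"
  unfolding asdim_le_def
proof (intro allI impI)
  fix R :: real assume R: "R > 0"
  interpret G: group G by (rule G)
  interpret M: Metric_space "carrier G" d
    using metric by (simp add: proper_right_invariant_metric_def)
  have inv: "d (x \<otimes>\<^bsub>G\<^esub> g) (y \<otimes>\<^bsub>G\<^esub> g) = d x y"
    if "x \<in> carrier G" "y \<in> carrier G" "g \<in> carrier G" for x y g
    using metric that by (simp add: proper_right_invariant_metric_def)
  have inv1: "d (f \<otimes>\<^bsub>G\<^esub> x) x = d f \<one>\<^bsub>G\<^esub>" if "f \<in> carrier G" "x \<in> carrier G" for f x
    using inv[of f "\<one>\<^bsub>G\<^esub>" x] that by simp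
  define F where "F = M.mcball \<one>\<^bsub>G\<^esub> R"
  have F: "finite F" "F \<subseteq> carrier G"
    using metric by (auto simp: F_def proper_right_invariant_metric_def)
  obtain S p where "coarse_partition G (carrier G) n F S p"
    using coarse_dim_leE[OF dim F] .
  note S = coarse_partitionD(1,2)[OF this] and p = coarse_partitionD(3-)[OF this]
  define U where "U g = {y \<in> carrier G. \<exists>f\<in>F. p (f \<otimes>\<^bsub>G\<^esub> y) = g}" for g
  \<comment> \<open>\<open>D\<close> bounds the distance from a point to its label, so every member
    of the cover has its points within \<open>R + D\<close> of the label.\<close>
  define D where "D = Max (insert 0 ((\<lambda>s. d s \<one>\<^bsub>G\<^esub>) ` S))"
  have D: "D \<ge> 0" "\<And>s. s \<in> S \<Longrightarrow> d s \<one>\<^bsub>G\<^esub> \<le> D"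
    using S(1) by (auto simp: D_def intro: Max_ge)
  have near: "d y g \<le> R + D" if "y \<in> U g" for y g
  proof -
    from that obtain f where f: "f \<in> F" "p (f \<otimes>\<^bsub>G\<^esub> y) = g" and y: "y \<in> carrier G"
      by (auto simp: U_def)
    have fG: "f \<in> carrier G" and fy: "f \<otimes>\<^bsub>G\<^esub> y \<in> carrier G" using f y F by auto
    obtain s where s: "s \<in> S" "f \<otimes>\<^bsub>G\<^esub> y = s \<otimes>\<^bsub>G\<^esub> g" using p(2)[OF fy] f by auto
    have gG: "g \<in> carrier G" using p(1)[OF fy] f by simp
    have "d y g \<le> d y (f \<otimes>\<^bsub>G\<^esub> y) + d (f \<otimes>\<^bsub>G\<^esub> y) g"
      by (rule M.triangle[OF y fy gG])
    also have "d y (f \<otimes>\<^bsub>G\<^esub> y) = d \<one>\<^bsub>G\<^esub> f"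
      using inv1[OF fG y] M.commute by metis
    also have "\<dots> \<le> R" using f(1) by (simp add: F_def)
    also have "d (f \<otimes>\<^bsub>G\<^esub> y) g = d s \<one>\<^bsub>G\<^esub>"
      unfolding s(2) using s(1) S(2) gG by (intro inv1) auto
    also have "\<dots> \<le> D" by (rule D(2)[OF s(1)])
    finally show ?thesis by simp
  qed
  show "\<exists>S>0. \<exists>\<U>. \<U> \<subseteq> Pow (carrier G) \<and> \<Union>\<U> = carrier G \<and> (\<forall>U\<in>\<U>. diam_le d U S) \<and>
      (\<forall>\<V>\<subseteq>\<U>. card \<V> = n + 2 \<longrightarrow> \<Inter>\<V> = {}) \<and>
      (\<forall>A\<subseteq>carrier G. A \<noteq> {} \<and> diam_le d A R \<longrightarrow> (\<exists>U\<in>\<U>. A \<subseteq> U))"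
  proof (intro exI[of _ "2 * (R + D)"] exI[of _ "U ` carrier G"] conjI ballI allI impI)
    show "0 < 2 * (R + D)" using R D(1) by simp
    show "U ` carrier G \<subseteq> Pow (carrier G)" by (auto simp: U_def)
    have "y \<in> U (p y)" if y: "y \<in> carrier G" for y
    proof -
      have "\<one>\<^bsub>G\<^esub> \<in> F" using R by (simp add: F_def)
      then show ?thesis using y by (auto simp: U_def intro!: bexI[of _ "\<one>\<^bsub>G\<^esub>"])
    qed
    then show "\<Union> (U ` carrier G) = carrier G"
      using p(1) by (fastforce simp: U_def)
  next
    fix X assume "X \<in> U ` carrier G"
    then obtain g where g: "g \<in> carrier G" "X = U g" by blast
    show "diam_le d X (2 * (R + D))"
      unfolding diam_le_def
    proof (intro ballI)
      fix x y assume xy: "x \<in> X" "y \<in> X"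
      then have G: "x \<in> carrier G" "y \<in> carrier G" by (auto simp: g U_def)
      have "d x y \<le> d x g + d g y" by (rule M.triangle[OF G(1) g(1) G(2)])
      also have "d g y = d y g" by (rule M.commute)
      finally show "d x y \<le> 2 * (R + D)" using near[of x g] near[of y g] xy g by auto
    qed
  next
    fix \<V> assume V: "\<V> \<subseteq> U ` carrier G" "card \<V> = n + 2"
    show "\<Inter>\<V> = {}"
    proof (rule ccontr)
      assume "\<Inter>\<V> \<noteq> {}"
      then obtain y where y: "\<And>X. X \<in> \<V> \<Longrightarrow> y \<in> X" by blast
      have "\<V> \<noteq> {}" using V(2) by auto
      then have yG: "y \<in> carrier G" using y V(1) by (fastforce simp: U_def)
      have "\<V> \<subseteq> U ` p ` (\<lambda>f. f \<otimes>\<^bsub>G\<^esub> y) ` F"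
      proof
        fix X assume X: "X \<in> \<V>"
        then obtain g where g: "X = U g" using V(1) by blast
        then obtain f where "f \<in> F" "p (f \<otimes>\<^bsub>G\<^esub> y) = g" using y[OF X] by (auto simp: U_def)
        then show "X \<in> U ` p ` (\<lambda>f. f \<otimes>\<^bsub>G\<^esub> y) ` F" using g by blast
      qed
      then have "card \<V> \<le> card (U ` p ` (\<lambda>f. f \<otimes>\<^bsub>G\<^esub> y) ` F)"
        using F(1) by (intro card_mono) auto
      also have "\<dots> \<le> card (p ` (\<lambda>f. f \<otimes>\<^bsub>G\<^esub> y) ` F)"
        using F(1) by (intro card_image_le) auto
      also have "\<dots> \<le> n + 1" by (rule p(3)[OF yG])
      finally show False using V(2) by simp
    qed
  next
    fix A assume A: "A \<subseteq> carrier G" "A \<noteq> {} \<and> diam_le d A R"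
    then obtain a where a: "a \<in> A" by blast
    \<comment> \<open>The cell of any one point serves: the element carrying \<open>y\<close> to
      \<open>a\<close> has distance \<open>d a y\<close> from the unit and therefore lies in
      \<open>F\<close>.\<close>
    have "A \<subseteq> U (p a)"
    proof
      fix y assume y: "y \<in> A"
      have G: "a \<in> carrier G" "y \<in> carrier G" using a y A by auto
      define f where "f = a \<otimes>\<^bsub>G\<^esub> inv\<^bsub>G\<^esub> y"
      have f: "f \<in> carrier G" "f \<otimes>\<^bsub>G\<^esub> y = a" using G by (simp_all add: f_def G.m_assoc)
      have "d \<one>\<^bsub>G\<^esub> f = d a y"
        using inv1[OF f(1) G(2)] f(2) M.commute by metis
      also have "\<dots> \<le> R" using A(2) a y by (simp add: diam_le_def)
      finally have "f \<in> F" using f by (simp add: F_def)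
      then show "y \<in> U (p a)" using f G by (auto simp: U_def)
    qed
    then show "\<exists>U\<in>U ` carrier G. A \<subseteq> U" using p(1) a A by blast
  qed
qed

theorem theorem2p12:
  fixes G :: "'a monoid" and d :: "'a \<Rightarrow> 'a \<Rightarrow> real"
  assumes "group G" and "countable (carrier G)"
    and "elementary_amenable G"
    and "proper_right_invariant_metric G d"
  shows "asdim (carrier G) d \<le> hirsch_length G"
proof (cases "hirsch_length G")
  case (enat n)
  \<comment> \<open>Once some value exists, the choice in \<open>hirsch_length\<close> returns a
    value, and the bound holds for every value.\<close>
  have "hirsch_value G (hirsch_length G)"
    unfolding hirsch_length_def using hirsch_value_exists[OF assms(3)] by (rule someI_ex)
  then have "coarse_dim_le G (carrier G) n"
    using coarse_dim_le_of_hirsch_value enat by (metis order_refl)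
  then have "asdim_le (carrier G) d n"
    by (rule asdim_le_of_coarse_dim_le[OF assms(1,4)])
  then show ?thesis
    by (auto simp: asdim_def enat intro: Least_le)
qed simp

end
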